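(* Let $\theta_0\in L^2(0,1)$, $T>0$, $\tau\in(0,T)$ and $s\in(1,2)$. Then there exists a function $y:[\tau,T]\to\mathbb{R}$, Gevrey of order $s$ on $[\tau,T]$, such that the control $$u(t):=\begin{cases}0 & \text{if } 0\le t\le\tau,\\ \displaystyle\sum_{i\ge 1}\frac{y^{(i)}(t)}{(2i-1)!} & \text{if } \tau<t\le T\end{cases}$$ steers the system $$\partial_t\theta-\partial_x^2\theta=0 \text{ on } (0,T)\times(0,1),\qquad \partial_x\theta(t,0)=0,\quad \partial_x\theta(t,1)=u(t),\ t\in(0,T),$$ from the initial state $\theta(0,\cdot)=\theta_0$ at time $0$ to the final state $\theta(T,\cdot)=0$ at time $T$. Moreover $u$ is Gevrey of order $s$ on $[0,T]$, and the solution $\theta$ of this system is Gevrey of order $s$ in $t$ and $s/2$ in $x$ on $[\varepsilon,T]\times[0,1]$ for all $\varepsilon\in(0,T)$.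
   Context: The solution of the heat equation with $L^2$ initial data is understood in the usual (weak/semigroup) sense, as a continuous function of $t\in[0,T]$ with values in $L^2(0,1)$. Gevrey functions: a function $y\in C^\infty([a,b])$ is Gevrey of order $s\ge 0$ on $[a,b]$ if there are constants $M,R>0$ with $|y^{(p)}(t)|\le M\,(p!)^s/R^p$ for all $t\in[a,b]$, $p\ge 0$. More generally, if $K\subset\mathbb{R}^d$ is compact and $y$ is of class $C^\infty$ on $K$ (i.e. the restriction to $K$ of a $C^\infty$ function on an open neighbourhood of $K$), $y$ is Gevrey of order $s_1$ in $x_1$, ..., $s_d$ in $x_d$ on $K$ if there are constants $M,R_1,\dots,R_d>0$ such that $|\partial_{x_1}^{p_1}\cdots\partial_{x_d}^{p_d}y(x)|\le M\prod_{i=1}^d (p_i!)^{s_i}/R_i^{p_i}$ for all $x\in K$ and $p\in\mathbb{N}^d$. *)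

theory Defs
  imports "HOL-Analysis.Analysis"
begin

section \<open>Gevrey functions on a compact interval\<close>

text \<open>Derivatives on \<open>[a,b]\<close> are one-sided at the endpoints, so for \<open>a < b\<close> the following
  depends only on the values of \<open>y\<close> on \<open>[a,b]\<close>.\<close>

definition deriv_on :: "real \<Rightarrow> real \<Rightarrow> nat \<Rightarrow> (real \<Rightarrow> real) \<Rightarrow> real \<Rightarrow> real" where
  "deriv_on a b p y = ((\<lambda>f t. vector_derivative f (at t within {a..b})) ^^ p) y"

definition smooth_on_interval :: "real \<Rightarrow> real \<Rightarrow> (real \<Rightarrow> real) \<Rightarrow> bool" where
  "smooth_on_interval a b y \<longleftrightarrow>
     (\<forall>p. \<forall>t\<in>{a..b}. deriv_on a b p y differentiable (at t within {a..b}))"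

definition gevrey_on_interval :: "real \<Rightarrow> real \<Rightarrow> real \<Rightarrow> (real \<Rightarrow> real) \<Rightarrow> bool" where
  "gevrey_on_interval s a b y \<longleftrightarrow>
     smooth_on_interval a b y \<and>
     (\<exists>M>0. \<exists>R>0. \<forall>t\<in>{a..b}. \<forall>p. \<bar>deriv_on a b p y t\<bar> \<le> M * fact p powr s / R ^ p)"


section \<open>Gevrey functions on a compact subset of the plane\<close>

definition partial :: "'a \<Rightarrow> ('a::euclidean_space \<Rightarrow> real) \<Rightarrow> 'a \<Rightarrow> real" where
  "partial b F z = frechet_derivative F (at z) b"

primrec Ck_on :: "nat \<Rightarrow> 'a set \<Rightarrow> ('a::euclidean_space \<Rightarrow> real) \<Rightarrow> bool" where
  "Ck_on 0 U F \<longleftrightarrow> continuous_on U F"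
| "Ck_on (Suc k) U F \<longleftrightarrow>
     (\<forall>z\<in>U. F differentiable (at z)) \<and> (\<forall>b\<in>Basis. Ck_on k U (partial b F))"

text \<open>As \<open>Ck_on\<close> uses full neighbourhoods, it is meant for open sets only.  A function on a compact
  set \<open>K\<close> is smooth if it is the restriction of a smooth \<open>F\<close> on an open neighbourhood; its
  derivatives on \<open>K\<close> are those of \<open>F\<close>, and do not depend on \<open>F\<close> when \<open>K\<close> is the closure of its
  interior (e.g. a nondegenerate rectangle).\<close>

definition gevrey_on_plane ::
    "real \<Rightarrow> real \<Rightarrow> (real \<times> real) set \<Rightarrow> (real \<times> real \<Rightarrow> real) \<Rightarrow> bool" where
  "gevrey_on_plane s1 s2 K g \<longleftrightarrow>
     (\<exists>U F. open U \<and> K \<subseteq> U \<and> (\<forall>k. Ck_on k U F) \<and> (\<forall>z\<in>K. F z = g z) \<and>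
       (\<exists>M>0. \<exists>R1>0. \<exists>R2>0. \<forall>z\<in>K. \<forall>p q.
          \<bar>(partial (1, 0) ^^ p) ((partial (0, 1) ^^ q) F) z\<bar>
            \<le> M * (fact p powr s1 / R1 ^ p) * (fact q powr s2 / R2 ^ q)))"


section \<open>The heat equation with Neumann control\<close>

abbreviation unit_measure :: "real measure" where
  "unit_measure \<equiv> lebesgue_on {0<..<1}"

text \<open>Elements of \<open>L\<^sup>2(0,1)\<close> are represented by functions, and equality in \<open>L\<^sup>2(0,1)\<close> is
  equality almost everywhere.\<close>

definition L2_unit :: "(real \<Rightarrow> real) set" where
  "L2_unit = {f \<in> borel_measurable unit_measure. integrable unit_measure (\<lambda>x. (f x)\<^sup>2)}"

definition L2_norm_unit :: "(real \<Rightarrow> real) \<Rightarrow> real" where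
  "L2_norm_unit f = sqrt (LINT x|unit_measure. (f x)\<^sup>2)"

definition continuous_into_L2 :: "real \<Rightarrow> (real \<Rightarrow> real \<Rightarrow> real) \<Rightarrow> bool" where
  "continuous_into_L2 T \<theta> \<longleftrightarrow>
     (\<forall>t\<in>{0..T}. \<theta> t \<in> L2_unit) \<and>
     (\<forall>t\<in>{0..T}. ((\<lambda>r. L2_norm_unit (\<lambda>x. \<theta> r x - \<theta> t x)) \<longlongrightarrow> 0) (at t within {0..T}))"

text \<open>Test functions \<open>\<phi>\<close> of class \<open>C\<^sup>2\<close> on \<open>[0,1]\<close> with homogeneous Neumann conditions
  (\<open>\<phi>1\<close>, \<open>\<phi>2\<close> are the first two derivatives).  They form a core of the Neumann Laplacian.\<close>

definition neumann_test ::
    "(real \<Rightarrow> real) \<Rightarrow> (real \<Rightarrow> real) \<Rightarrow> (real \<Rightarrow> real) \<Rightarrow> bool" where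
  "neumann_test \<phi> \<phi>1 \<phi>2 \<longleftrightarrow>
     (\<forall>x\<in>{0..1}. (\<phi> has_real_derivative \<phi>1 x) (at x within {0..1})) \<and>
     (\<forall>x\<in>{0..1}. (\<phi>1 has_real_derivative \<phi>2 x) (at x within {0..1})) \<and>
     continuous_on {0..1} \<phi>2 \<and> \<phi>1 0 = 0 \<and> \<phi>1 1 = 0"

text \<open>Weak solutions in \<open>C([0,T]; L\<^sup>2(0,1))\<close> of
  \<open>\<theta>\<^sub>t - \<theta>\<^sub>x\<^sub>x = 0\<close>, \<open>\<theta>\<^sub>x(t,0) = 0\<close>, \<open>\<theta>\<^sub>x(t,1) = u(t)\<close>, \<open>\<theta>(0,x) = \<theta>0(x)\<close>.
  The identity arises by multiplying with \<open>\<phi>\<close>, integrating by parts twice in \<open>x\<close>, and integrating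
  over \<open>[0,t]\<close>.  As the test functions form a core, this is the same as being the mild solution
  given by the Neumann heat semigroup.\<close>

definition heat_solution ::
    "real \<Rightarrow> (real \<Rightarrow> real) \<Rightarrow> (real \<Rightarrow> real) \<Rightarrow> (real \<Rightarrow> real \<Rightarrow> real) \<Rightarrow> bool" where
  "heat_solution T \<theta>0 u \<theta> \<longleftrightarrow>
     integrable (lebesgue_on {0..T}) u \<and>
     continuous_into_L2 T \<theta> \<and>
     (AE x in unit_measure. \<theta> 0 x = \<theta>0 x) \<and>
     (\<forall>\<phi> \<phi>1 \<phi>2. neumann_test \<phi> \<phi>1 \<phi>2 \<longrightarrow> (\<forall>t\<in>{0..T}.
        (LINT x|unit_measure. \<theta> t x * \<phi> x) =
          (LINT x|unit_measure. \<theta>0 x * \<phi> x) +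
          (LINT r|lebesgue_on {0..t}. (LINT x|unit_measure. \<theta> r x * \<phi>2 x) + u r * \<phi> 1)))"

text \<open>The summation index is shifted: summand \<open>i\<close> is the term \<open>y\<^sup>(\<^sup>j\<^sup>)(t) / (2j-1)!\<close> with
  \<open>j = Suc i\<close>.\<close>

definition control_term :: "real \<Rightarrow> real \<Rightarrow> (real \<Rightarrow> real) \<Rightarrow> real \<Rightarrow> nat \<Rightarrow> real" where
  "control_term \<tau> T y t i = deriv_on \<tau> T (Suc i) y t / fact (2 * Suc i - 1)"

definition control :: "real \<Rightarrow> real \<Rightarrow> (real \<Rightarrow> real) \<Rightarrow> real \<Rightarrow> real" where
  "control \<tau> T y t = (if t \<le> \<tau> then 0 else (\<Sum>i. control_term \<tau> T y t i))"

end

theory Submission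
  imports Defs "HOL-Complex_Analysis.Complex_Analysis"
begin

text \<open>Flatness.  If \<open>Y\<close> is Gevrey of order \<open>s < 2\<close>, then \<open>\<theta>(t,x) = \<Sum> Y\<^sup>(\<^sup>i\<^sup>)(t) x\<^bsup>2i\<^esup> / (2i)!\<close>
  converges and solves the heat equation with \<open>\<theta>\<^sub>x(t,0) = 0\<close> and \<open>\<theta>\<^sub>x(t,1) = \<Sum> Y\<^sup>(\<^sup>i\<^sup>)(t) / (2i-1)!\<close>.
  The uncontrolled solution starting at \<open>\<theta>0\<close> has this form for \<open>t > 0\<close>, its trace at \<open>x = 0\<close> being
  Gevrey of order 1 away from \<open>t = 0\<close>.  Multiplying this trace by a Gevrey cutoff that is 1 up to time
  \<open>\<tau>\<close> and 0 from time \<open>T\<close> on gives a \<open>Y\<close> whose solution agrees with the uncontrolled one up to time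
  \<open>\<tau>\<close> and vanishes at time \<open>T\<close>.  Testing with the cosines shows that the weak solution is unique.

  Smooth functions on the line are handled through the sequence \<open>f 0, f 1, f 2, \<dots>\<close> of their
  derivatives.\<close>

section \<open>Gevrey cutoff functions\<close>

text \<open>The two ends of the interval 1 < s < 2 enter separately. A cutoff that is constant on
  intervals cannot be analytic, hence s > 1. In the series, \<open>(i!)^s / (2i)!\<close> behaves
  like \<open>(2i)!\<close> to the power \<open>s / 2 - 1\<close> up to a geometric factor, so s < 2
  makes it converge for every x; and since a time derivative counts as two space derivatives, order
  s in t becomes order s/2 in x. That the free solution is the flat series of its trace is an
  exchange of two sums, over the eigenvalue index and over the power of x. Its majorant grows like
  \<open>exp (n * pi * |x|)\<close>, which the Gaussian factor \<open>exp (- (n * pi)^2 * t)\<close>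
  beats for every t > 0. The delicate time is t = 0, where the data are only square integrable and Y
  may blow up. All bounds are therefore taken on half lines starting at some
  \<open>\<epsilon> > 0\<close>, and continuity at t = 0 is proved in L2 by Parseval's
  identity.\<close>

lemma power_le_fact_exp:
  fixes x :: real
  assumes "0 \<le> x"
  shows "x ^ k \<le> fact k * exp x"
proof -
  have "(\<Sum>n\<in>{k}. x ^ n /\<^sub>R fact n) \<le> (\<Sum>n. x ^ n /\<^sub>R fact n)"
    using assms by (intro sum_le_suminf summable_exp_generic) auto
  then have "x ^ k / fact k \<le> exp x"
    by (simp add: exp_def divide_inverse mult.commute)
  then show ?thesis by (simp add: field_simps)
qed

text \<open>Derivatives of the flat function \<open>exp (-1 / t\<^sup>m)\<close> for \<open>t > 0\<close>, \<open>0\<close> for \<open>t \<le> 0\<close>.  Cauchy's inequality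
  on the disc of radius \<open>c t\<close> around \<open>t\<close> gives \<open>k! (c t)\<^bsup>-k\<^esup> exp (-1 / (2 t\<^sup>m))\<close>, hence Gevrey
  order \<open>1 + 1/m\<close>.\<close>

definition flat_deriv :: "nat \<Rightarrow> nat \<Rightarrow> real \<Rightarrow> real" where
  "flat_deriv m k t =
     (if t \<le> 0 then 0 else Re ((deriv ^^ k) (\<lambda>z. exp (- (1 / z ^ m))) (complex_of_real t)))"

text \<open>Scaling by \<open>w = z / t\<close> carries the disc of radius \<open>c * t\<close>
  about t to a disc about 1, so one \<open>c\<close>, independent of t, keeps
  \<open>Re (1 / z ^ m)\<close> at least \<open>1 / (2 * t ^ m)\<close> on all of them.
  \<open>c < 1\<close> keeps the pole at 0 outside.\<close>

lemma Re_inverse_power_near_one: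
  obtains c where "0 < c" "c < 1" "\<And>w::complex. cmod (w - 1) \<le> c \<Longrightarrow> 1 / 2 \<le> Re (1 / w ^ m)"
proof -
  have "isCont (\<lambda>w::complex. Re (1 / w ^ m)) 1"
    unfolding isCont_def by (rule tendsto_eq_intros refl | simp)+
  then have "\<exists>d>0. \<forall>w::complex. norm (w - 1) < d \<longrightarrow> norm (Re (1 / w ^ m) - Re (1 / 1 ^ m)) < 1/2"
    unfolding continuous_at_eps_delta dist_norm by (elim allE[of _ "1/2"]) simp
  then obtain d where d: "d > 0" "\<And>w::complex. cmod (w - 1) < d \<Longrightarrow> \<bar>Re (1 / w ^ m) - 1\<bar> < 1/2"
    by auto
  have "1 / 2 \<le> Re (1 / w ^ m)" if "cmod (w - 1) \<le> min (d/2) (1/2)" for w :: complex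
    using d(2)[of w] that d(1) by (auto simp: abs_if split: if_splits)
  with d(1) show ?thesis by (intro that[of "min (d/2) (1/2)"]) auto
qed

text \<open>With \<open>x = 1 / t ^ m\<close>, the m-th power of the left side is at most
  \<open>x ^ k * exp (- x / 2)\<close>, which a single term of the exponential series bounds by a
  multiple of \<open>fact k\<close>. The m-th root turns this into
  \<open>fact k powr (1 / m)\<close>, the excess of the Gevrey order over 1.\<close>

lemma power_times_exp_bound:
  fixes t :: real
  assumes "0 < t" "0 < m"
  shows "(1 / t) ^ k * exp (- (1 / t ^ m) / 2) \<le> fact k powr (1 / m) * 2 ^ k"
proof -
  define x where "x = 1 / t ^ m"
  have x: "x > 0" using assms by (simp add: x_def)
  define L where "L = (1 / t) ^ k * exp (- (1 / t ^ m) / 2)"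
  have L: "L > 0" using assms by (simp add: L_def)
  have "L ^ m = x ^ k * exp (- x / 2) ^ m"
    by (simp add: L_def power_mult_distrib x_def power_divide flip: power_mult) (simp add: mult.commute)
  also have "\<dots> \<le> x ^ k * exp (- x / 2) ^ 1"
    using x assms by (intro mult_left_mono power_decreasing) auto
  also have "\<dots> = 2 ^ k * (x / 2) ^ k * exp (- x / 2)"
    by (simp add: power_divide)
  also have "\<dots> \<le> 2 ^ k * (fact k * exp (x / 2)) * exp (- x / 2)"
    using x by (intro mult_left_mono mult_right_mono power_le_fact_exp) auto
  also have "\<dots> = fact k * 2 ^ k"
    by (simp add: exp_minus)
  \<comment> \<open>This loss makes the m-th root of the constant come out as
    \<open>2 ^ k\<close>.\<close>
  also have "\<dots> \<le> fact k * (2 ^ k) ^ m"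
    using assms by (intro mult_left_mono self_le_power) auto
  finally have "(L ^ m) powr (1 / m) \<le> (fact k * (2 ^ k) ^ m) powr (1 / m)"
    using L by (intro powr_mono2) auto
  also have "\<dots> = fact k powr (1 / m) * 2 ^ k"
    using assms by (simp add: powr_mult powr_powr flip: powr_realpow)
  also have "(L ^ m) powr (1 / m) = L"
    using L assms by (simp add: powr_powr flip: powr_realpow[OF L])
  finally show ?thesis by (simp add: L_def)
qed

lemma flat_deriv_bound:
  assumes "0 < m"
  obtains c where "0 < c"
    "\<And>k t. 0 < t \<Longrightarrow> \<bar>flat_deriv m k t\<bar> \<le> fact k / (c * t) ^ k * exp (- (1 / t ^ m) / 2)"
proof -
  obtain c where c: "0 < c" "c < 1" "\<And>w::complex. cmod (w - 1) \<le> c \<Longrightarrow> 1 / 2 \<le> Re (1 / w ^ m)"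
    using Re_inverse_power_near_one[of m] by metis
  have "\<bar>flat_deriv m k t\<bar> \<le> fact k / (c * t) ^ k * exp (- (1 / t ^ m) / 2)" if t: "0 < t" for k t
  proof -
    let ?F = "\<lambda>z::complex. exp (- (1 / z ^ m))"
    have nz: "z \<noteq> 0" if "z \<in> cball (complex_of_real t) (c * t)" for z
    proof
      assume "z = 0"
      with that t have "t \<le> c * t" by (simp add: dist_norm)
      moreover have "c * t < 1 * t" using t c by (intro mult_strict_right_mono) auto
      ultimately show False by simp
    qed
    have "cmod ((deriv ^^ k) ?F (complex_of_real t))
            \<le> fact k * exp (- (1 / t ^ m) / 2) / (c * t) ^ k"
    proof (rule Cauchy_inequality)
      show "?F holomorphic_on ball (complex_of_real t) (c * t)"
        using nz by (intro holomorphic_intros) (auto simp: dist_norm)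
      show "continuous_on (cball (complex_of_real t) (c * t)) ?F"
        using nz by (intro continuous_intros) auto
      show "0 < c * t" using c t by simp
      fix z :: complex assume z: "cmod (complex_of_real t - z) = c * t"
      define w where "w = z / complex_of_real t"
      have "w - 1 = - ((complex_of_real t - z) / complex_of_real t)"
        using t by (simp add: w_def field_simps)
      then have "cmod (w - 1) = c"
        using z t by (simp add: norm_divide)
      then have "1 / 2 \<le> Re (1 / w ^ m)" using c(3)[of w] by simp
      moreover have "1 / z ^ m = complex_of_real (1 / t ^ m) * (1 / w ^ m)"
        using t by (simp add: w_def power_divide)
      then have "Re (1 / z ^ m) = 1 / t ^ m * Re (1 / w ^ m)"
        by (simp only: Re_complex_of_real Im_complex_of_real times_complex.sel)
      ultimately have "1 / t ^ m * (1 / 2) \<le> Re (1 / z ^ m)"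
        using t by (simp only:) (intro mult_left_mono, auto)
      then show "cmod (?F z) \<le> exp (- (1 / t ^ m) / 2)"
        by (simp only: norm_exp_eq_Re) simp
    qed
    then have "\<bar>Re ((deriv ^^ k) ?F (complex_of_real t))\<bar>
            \<le> fact k * exp (- (1 / t ^ m) / 2) / (c * t) ^ k"
      using abs_Re_le_cmod order_trans by blast
    then show ?thesis using t by (simp add: flat_deriv_def)
  qed
  with c(1) show ?thesis by (rule that)
qed

text \<open>The power \<open>t ^ j\<close> is free to choose: \<open>j = 0\<close> gives the uniform
  Gevrey bound, \<open>j = 2\<close> the differentiability at 0.\<close>

lemma flat_deriv_bound_power:
  assumes "0 < m"
  obtains c where "0 < c"
    "\<And>k j t. 0 < t \<Longrightarrow> \<bar>flat_deriv m k t\<bar> \<le> (fact k / c ^ k * (fact (k + j) powr (1 / m) * 2 ^ (k + j))) * t ^ j"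
proof -
  obtain c where c: "0 < c"
    "\<And>k t. 0 < t \<Longrightarrow> \<bar>flat_deriv m k t\<bar> \<le> fact k / (c * t) ^ k * exp (- (1 / t ^ m) / 2)"
    using flat_deriv_bound[OF assms] by metis
  show ?thesis
  proof (rule that[OF c(1)])
    fix k j :: nat and t :: real assume t: "0 < t"
    have "\<bar>flat_deriv m k t\<bar> \<le> fact k / (c * t) ^ k * exp (- (1 / t ^ m) / 2)"
      by (rule c(2)[OF t])
    also have "\<dots> = fact k / c ^ k * ((1 / t) ^ (k + j) * exp (- (1 / t ^ m) / 2)) * t ^ j"
      using t c(1) by (simp add: field_simps power_add)
    also have "\<dots> \<le> fact k / c ^ k * (fact (k + j) powr (1 / m) * 2 ^ (k + j)) * t ^ j"
      using t c(1) assms by (intro mult_right_mono mult_left_mono power_times_exp_bound) auto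
    finally show "\<bar>flat_deriv m k t\<bar> \<le> (fact k / c ^ k * (fact (k + j) powr (1 / m) * 2 ^ (k + j))) * t ^ j" .
  qed
qed

lemma has_real_derivative_flat_deriv:
  assumes "0 < m"
  shows "(flat_deriv m k has_real_derivative flat_deriv m (Suc k) t) (at t)"
proof (cases t "0 :: real" rule: linorder_cases)
  case less
  have "eventually (\<lambda>r. r < 0) (nhds t)"
    using less by (intro order_tendstoD) (auto intro: filterlim_ident)
  then have "eventually (\<lambda>r. flat_deriv m k r = 0) (nhds t)"
    by eventually_elim (simp add: flat_deriv_def)
  then have "(flat_deriv m k has_real_derivative 0) (at t) \<longleftrightarrow> ((\<lambda>_. 0) has_real_derivative 0) (at t)"
    by (intro DERIV_cong_ev) auto
  then show ?thesis using less by (simp add: flat_deriv_def)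
next
  case greater
  let ?F = "\<lambda>z::complex. exp (- (1 / z ^ m))"
  have "?F holomorphic_on - {0}" by (intro holomorphic_intros) auto
  then have "(deriv ^^ k) ?F holomorphic_on - {0}"
    by (intro holomorphic_higher_deriv) auto
  then have "((deriv ^^ k) ?F has_field_derivative deriv ((deriv ^^ k) ?F) (complex_of_real t)) (at (complex_of_real t))"
    using greater by (intro holomorphic_derivI) auto
  then have "((\<lambda>x. (deriv ^^ k) ?F (complex_of_real x)) has_vector_derivative (deriv ^^ Suc k) ?F (complex_of_real t)) (at t)"
    by (intro has_vector_derivative_real_field) auto
  then have "((\<lambda>x. Re ((deriv ^^ k) ?F (complex_of_real x))) has_vector_derivative Re ((deriv ^^ Suc k) ?F (complex_of_real t))) (at t)"
    by (rule bounded_linear.has_vector_derivative[OF bounded_linear_Re])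
  then have D: "((\<lambda>x. Re ((deriv ^^ k) ?F (complex_of_real x))) has_real_derivative flat_deriv m (Suc k) t) (at t)"
    using greater by (simp add: has_real_derivative_iff_has_vector_derivative flat_deriv_def)
  have "eventually (\<lambda>r. r > 0) (nhds t)"
    using greater by (intro order_tendstoD) (auto intro: filterlim_ident)
  then have "eventually (\<lambda>r. Re ((deriv ^^ k) ?F (complex_of_real r)) = flat_deriv m k r) (nhds t)"
    by eventually_elim (simp add: flat_deriv_def)
  from DERIV_cong_ev[OF refl this refl] D show ?thesis
    by blast
next
  case equal
  obtain c where c: "0 < c"
    "\<And>k j t. 0 < t \<Longrightarrow> \<bar>flat_deriv m k t\<bar> \<le> (fact k / c ^ k * (fact (k + j) powr (1 / m) * 2 ^ (k + j))) * t ^ j"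
    using flat_deriv_bound_power[OF assms] by metis
  \<comment> \<open>The constant for \<open>j = 2\<close>: after division by h a factor h remains,
    so the difference quotient tends to 0.\<close>
  define K where "K = fact k / c ^ k * (fact (k + 2) powr (1 / m) * 2 ^ (k + 2))"
  have K: "K \<ge> 0" using c(1) by (simp add: K_def)
  have b: "\<bar>flat_deriv m k h / h\<bar> \<le> K * \<bar>h\<bar>" for h
  proof (cases "h > 0")
    case True
    then have "\<bar>flat_deriv m k h\<bar> \<le> K * h ^ 2"
      using c(2)[of h k 2] by (simp add: K_def)
    then have "\<bar>flat_deriv m k h\<bar> / h \<le> K * h"
      using True by (simp add: pos_divide_le_eq power2_eq_square mult.assoc)
    then show ?thesis using True by (simp add: abs_divide)
  qed (use K in \<open>simp add: flat_deriv_def mult_nonneg_nonpos\<close>)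
  have "((\<lambda>h. flat_deriv m k h / h) \<longlongrightarrow> 0) (at 0)"
  proof (rule Lim_null_comparison)
    show "\<forall>\<^sub>F h in at 0. norm (flat_deriv m k h / h) \<le> K * \<bar>h\<bar>"
      using b by auto
    show "((\<lambda>h. K * \<bar>h\<bar>) \<longlongrightarrow> 0) (at 0)"
      by (rule tendsto_eq_intros refl | simp)+
  qed
  then show ?thesis using equal by (simp add: DERIV_def flat_deriv_def)
qed

lemma flat_deriv_gevrey:
  assumes "0 < m" "1 + 1 / m \<le> s"
  obtains M R where "0 < M" "0 < R" "\<And>k t. \<bar>flat_deriv m k t\<bar> \<le> M * fact k powr s * R ^ k"
proof -
  obtain c where c: "0 < c"
    "\<And>k j t. 0 < t \<Longrightarrow> \<bar>flat_deriv m k t\<bar> \<le> (fact k / c ^ k * (fact (k + j) powr (1 / m) * 2 ^ (k + j))) * t ^ j"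
    using flat_deriv_bound_power[OF assms(1)] by metis
  have "\<bar>flat_deriv m k t\<bar> \<le> 1 * fact k powr s * (2 / c) ^ k" for k t
  proof (cases "t > 0")
    case True
    have "\<bar>flat_deriv m k t\<bar> \<le> fact k / c ^ k * (fact k powr (1 / m) * 2 ^ k)"
      using c(2)[OF True, of k 0] by simp
    also have "\<dots> = fact k powr (1 + 1 / m) * (2 / c) ^ k"
      by (simp add: powr_add power_divide)
    also have "\<dots> \<le> fact k powr s * (2 / c) ^ k"
      using assms c(1) by (intro mult_right_mono powr_mono) (auto simp: fact_ge_1)
    finally show ?thesis by simp
  qed (use c(1) in \<open>simp add: flat_deriv_def\<close>)
  then show ?thesis using c(1) by (intro that[of 1 "2 / c"]) auto
qed

lemma flat_deriv_0_pos: "0 < t \<Longrightarrow> 0 < flat_deriv m 0 t"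
proof -
  assume t: "0 < t"
  have "exp (- (1 / complex_of_real t ^ m)) = complex_of_real (exp (- (1 / t ^ m)))"
    by (simp flip: exp_of_real)
  then show ?thesis using t by (simp only: flat_deriv_def funpow_0) simp
qed

lemma flat_deriv_nonpos [simp]: "t \<le> 0 \<Longrightarrow> flat_deriv m k t = 0"
  by (simp add: flat_deriv_def)

section \<open>Derivative sequences, Gevrey bounds and the Leibniz product\<close>

definition deriv_seq :: "real set \<Rightarrow> (nat \<Rightarrow> real \<Rightarrow> real) \<Rightarrow> bool" where
  "deriv_seq S f \<longleftrightarrow> (\<forall>k. \<forall>t\<in>S. (f k has_real_derivative f (Suc k) t) (at t))"

text \<open>\<open>R\<close> is the reciprocal of the radius in \<open>gevrey_on_interval\<close>,
  so that a bound is weakened by enlarging it.\<close>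

definition gevrey_bound :: "real \<Rightarrow> real set \<Rightarrow> (nat \<Rightarrow> real \<Rightarrow> real) \<Rightarrow> bool" where
  "gevrey_bound s K f \<longleftrightarrow> (\<exists>M>0. \<exists>R>0. \<forall>t\<in>K. \<forall>k. \<bar>f k t\<bar> \<le> M * fact k powr s * R ^ k)"

lemma deriv_seqD: "deriv_seq S f \<Longrightarrow> t \<in> S \<Longrightarrow> (f k has_real_derivative f (Suc k) t) (at t)"
  by (simp add: deriv_seq_def)

lemma deriv_seq_continuous: "deriv_seq S f \<Longrightarrow> continuous_on S (f k)"
  by (metis DERIV_continuous_on deriv_seqD has_field_derivative_at_within)

lemma gevrey_bound_subset: "gevrey_bound s K f \<Longrightarrow> K' \<subseteq> K \<Longrightarrow> gevrey_bound s K' f"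
  unfolding gevrey_bound_def by blast

lemma gevrey_boundE:
  assumes "gevrey_bound s K f"
  obtains M R where "0 < M" "1 \<le> R" "\<And>t k. t \<in> K \<Longrightarrow> \<bar>f k t\<bar> \<le> M * fact k powr s * R ^ k"
proof -
  obtain M R where *: "0 < M" "0 < R" "\<And>t k. t \<in> K \<Longrightarrow> \<bar>f k t\<bar> \<le> M * fact k powr s * R ^ k"
    using assms unfolding gevrey_bound_def by blast
  show ?thesis
  proof (rule that[OF *(1), of "max 1 R"])
    fix t k assume "t \<in> K"
    then have "\<bar>f k t\<bar> \<le> M * fact k powr s * R ^ k" by (rule *(3))
    also have "\<dots> \<le> M * fact k powr s * max 1 R ^ k"
      using * by (intro mult_left_mono power_mono) auto
    finally show "\<bar>f k t\<bar> \<le> M * fact k powr s * max 1 R ^ k" .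
  qed simp
qed

lemma gevrey_bound_mono:
  assumes "gevrey_bound s K f" "s \<le> s'"
  shows "gevrey_bound s' K f"
proof -
  obtain M R where *: "0 < M" "1 \<le> R" "\<And>t k. t \<in> K \<Longrightarrow> \<bar>f k t\<bar> \<le> M * fact k powr s * R ^ k"
    using gevrey_boundE[OF assms(1)] by metis
  have "\<bar>f k t\<bar> \<le> M * fact k powr s' * R ^ k" if "t \<in> K" for t k
  proof -
    have "M * fact k powr s * R ^ k \<le> M * fact k powr s' * R ^ k"
      using * assms(2) by (intro mult_left_mono mult_right_mono powr_mono) (auto simp: fact_ge_1)
    with *(3)[OF that, of k] show ?thesis by linarith
  qed
  then show ?thesis
    using * unfolding gevrey_bound_def by (intro exI[of _ M] exI[of _ R] conjI) auto
qed

definition leibniz :: "(nat \<Rightarrow> real \<Rightarrow> real) \<Rightarrow> (nat \<Rightarrow> real \<Rightarrow> real) \<Rightarrow> nat \<Rightarrow> real \<Rightarrow> real" where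
  "leibniz f g k t = (\<Sum>j\<le>k. real (k choose j) * f j t * g (k - j) t)"

lemma leibniz_0 [simp]: "leibniz f g 0 t = f 0 t * g 0 t"
  by (simp add: leibniz_def)

lemma deriv_seq_leibniz:
  assumes f: "deriv_seq S f" and g: "deriv_seq S g"
  shows "deriv_seq S (leibniz f g)"
  unfolding deriv_seq_def
proof (intro allI ballI)
  fix k t assume t: "t \<in> S"
  have "((\<lambda>t. \<Sum>j\<le>k. real (k choose j) * f j t * g (k - j) t) has_real_derivative
      (\<Sum>j\<le>k. real (k choose j) * f (Suc j) t * g (k - j) t + real (k choose j) * f j t * g (Suc (k - j)) t)) (at t)"
    by (rule DERIV_sum) (auto intro!: derivative_eq_intros deriv_seqD[OF f t] deriv_seqD[OF g t]
      simp: algebra_simps)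
  moreover have "(\<Sum>j\<le>k. real (k choose j) * f (Suc j) t * g (k - j) t + real (k choose j) * f j t * g (Suc (k - j)) t)
      = leibniz f g (Suc k) t"
  proof -
    \<comment> \<open>The extra term \<open>j = Suc k\<close> is free because
      \<open>k choose Suc k\<close> is 0; splitting off \<open>j = 0\<close> then sets up Pascal's
      rule.\<close>
    have "(\<Sum>j\<le>k. real (k choose j) * f j t * g (Suc (k - j)) t)
        = (\<Sum>j\<le>Suc k. real (k choose j) * f j t * g (Suc k - j) t)"
      by (simp add: Suc_diff_le)
    also have "\<dots> = f 0 t * g (Suc k) t + (\<Sum>j\<le>k. real (k choose Suc j) * f (Suc j) t * g (k - j) t)"
      by (simp only: sum.atMost_Suc_shift) simp
    moreover have "leibniz f g (Suc k) t = f 0 t * g (Suc k) t +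
        (\<Sum>j\<le>k. real (k choose j) * f (Suc j) t * g (k - j) t + real (k choose Suc j) * f (Suc j) t * g (k - j) t)"
      by (simp only: leibniz_def sum.atMost_Suc_shift) (simp add: algebra_simps)
    ultimately show ?thesis by (simp add: sum.distrib)
  qed
  ultimately show "(leibniz f g k has_real_derivative leibniz f g (Suc k) t) (at t)"
    by (simp add: leibniz_def[abs_def])
qed

text \<open>Since \<open>fact j * fact (k - j) \<le> fact k\<close> and \<open>0 \<le> s\<close>,
  all products in the Leibniz sum share one bound of order s. The binomial coefficients add up to
  \<open>2 ^ k\<close>, which only doubles the geometric constant.\<close>

lemma gevrey_bound_leibniz:
  assumes f: "gevrey_bound s K f" and g: "gevrey_bound s K g" and s: "0 \<le> s"
  shows "gevrey_bound s K (leibniz f g)"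
proof -
  obtain M R where F: "0 < M" "1 \<le> R" "\<And>t k. t \<in> K \<Longrightarrow> \<bar>f k t\<bar> \<le> M * fact k powr s * R ^ k"
    using gevrey_boundE[OF f] by metis
  obtain M' R' where G: "0 < M'" "1 \<le> R'" "\<And>t k. t \<in> K \<Longrightarrow> \<bar>g k t\<bar> \<le> M' * fact k powr s * R' ^ k"
    using gevrey_boundE[OF g] by metis
  define Q where "Q = max R R'"
  have Q: "R \<le> Q" "R' \<le> Q" "1 \<le> Q" using F by (auto simp: Q_def)
  have "\<bar>leibniz f g k t\<bar> \<le> M * M' * fact k powr s * (2 * Q) ^ k" if t: "t \<in> K" for t k
  proof -
    have "\<bar>leibniz f g k t\<bar> \<le> (\<Sum>j\<le>k. \<bar>real (k choose j) * f j t * g (k - j) t\<bar>)"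
      unfolding leibniz_def by (rule sum_abs)
    also have "\<dots> \<le> (\<Sum>j\<le>k. real (k choose j) * (M * M' * fact k powr s * Q ^ k))"
    proof (rule sum_mono)
      fix j assume "j \<in> {..k}"
      then have j: "j \<le> k" by simp
      have "fact j * fact (k - j) \<le> (fact k :: nat)"
        using binomial_fact_lemma[OF j] zero_less_binomial[OF j]
        by (metis Suc_leI mult.right_neutral mult_le_mono2 One_nat_def)
      then have le: "fact j * fact (k - j) \<le> (fact k :: real)"
        by (metis (mono_tags) of_nat_fact of_nat_le_iff of_nat_mult)
      have "\<bar>f j t\<bar> * \<bar>g (k - j) t\<bar> \<le> (M * fact j powr s * R ^ j) * (M' * fact (k - j) powr s * R' ^ (k - j))"
        using F(1,2) by (intro mult_mono F(3)[OF t] G(3)[OF t]) auto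
      also have "\<dots> \<le> (M * fact j powr s * Q ^ j) * (M' * fact (k - j) powr s * Q ^ (k - j))"
        using F G Q by (intro mult_mono mult_left_mono power_mono) auto
      also have "\<dots> = M * M' * (fact j * fact (k - j)) powr s * (Q ^ j * Q ^ (k - j))"
        by (simp add: powr_mult)
      also have "Q ^ j * Q ^ (k - j) = Q ^ k"
        using j by (simp flip: power_add)
      also have "M * M' * (fact j * fact (k - j)) powr s * Q ^ k \<le> M * M' * fact k powr s * Q ^ k"
        using F G Q s le by (intro mult_left_mono mult_right_mono powr_mono2) auto
      finally have "\<bar>f j t\<bar> * \<bar>g (k - j) t\<bar> \<le> M * M' * fact k powr s * Q ^ k" .
      then show "\<bar>real (k choose j) * f j t * g (k - j) t\<bar>
          \<le> real (k choose j) * (M * M' * fact k powr s * Q ^ k)"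
        by (simp only: abs_mult mult.assoc abs_of_nat) (rule mult_left_mono, auto)
    qed
    also have "\<dots> = real (\<Sum>j\<le>k. k choose j) * (M * M' * fact k powr s * Q ^ k)"
      by (simp add: sum_distrib_right)
    also have "\<dots> = M * M' * fact k powr s * (2 * Q) ^ k"
      by (simp only: choose_row_sum) (simp add: power_mult_distrib)
    finally show ?thesis .
  qed
  then show ?thesis
    using F G Q unfolding gevrey_bound_def
    by (intro exI[of _ "M * M'"] exI[of _ "2 * Q"] conjI) auto
qed

text \<open>The bump is the product of the flat functions of \<open>t - a\<close> and
  \<open>b - t\<close>, each of which switches off at one end; the sign in \<open>g\<close> comes
  from the reflection.\<close>

lemma exists_gevrey_bump:
  assumes "1 < s" "a < (b::real)"
  obtains \<psi> where "deriv_seq UNIV \<psi>" "gevrey_bound s UNIV \<psi>"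
    "\<And>k t. t \<le> a \<or> b \<le> t \<Longrightarrow> \<psi> k t = 0" "\<And>t. a < t \<Longrightarrow> t < b \<Longrightarrow> 0 < \<psi> 0 t"
proof -
  \<comment> \<open>For \<open>s > 1\<close> this says \<open>1 / m < s - 1\<close>, so the flat
    function has order at most s.\<close>
  obtain m :: nat where m: "1 / (s - 1) < real m"
    using reals_Archimedean2 by blast
  then have m0: "0 < m" using assms(1) by (intro Nat.gr0I) (auto simp: not_less divide_less_0_iff)
  have m1: "1 + 1 / m \<le> s"
    using m m0 assms(1) by (simp add: field_simps)
  obtain M R where MR: "0 < M" "0 < R" "\<And>k t. \<bar>flat_deriv m k t\<bar> \<le> M * fact k powr s * R ^ k"
    using flat_deriv_gevrey[OF m0 m1] by metis
  define f where "f k t = flat_deriv m k (t - a)" for k t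
  define g where "g k t = (- 1) ^ k * flat_deriv m k (b - t)" for k t
  have chain: "((\<lambda>t. flat_deriv m k (h t)) has_real_derivative flat_deriv m (Suc k) (h t) * h') (at t)"
    if "(h has_real_derivative h') (at t)" for h h' k t
    by (rule DERIV_chain2[OF has_real_derivative_flat_deriv[OF m0] that])
  have "deriv_seq UNIV f"
    unfolding deriv_seq_def f_def
    by (auto intro!: derivative_eq_intros chain[THEN DERIV_cong])
  moreover have "deriv_seq UNIV g"
    unfolding deriv_seq_def g_def
    by (auto intro!: derivative_eq_intros chain[THEN DERIV_cong])
  moreover have "gevrey_bound s UNIV f" "gevrey_bound s UNIV g"
    using MR by (auto simp: gevrey_bound_def f_def g_def abs_mult power_abs)
  moreover have "leibniz f g k t = 0" if "t \<le> a \<or> b \<le> t" for k t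
    using that by (auto simp: leibniz_def f_def g_def)
  moreover have "0 < leibniz f g 0 t" if "a < t" "t < b" for t
    using that by (simp add: f_def g_def flat_deriv_0_pos)
  ultimately show ?thesis
    using assms(1) by (intro that[of "leibniz f g"] deriv_seq_leibniz gevrey_bound_leibniz) auto
qed

text \<open>One minus the normalised integral of a bump on [a, b] descends from 1 to 0, and its
  derivatives are those of the bump, one order later. Since \<open>0 < a\<close>, integration from 0
  misses nothing of the bump; times \<open>t > 0\<close> are all that the heat trace has.\<close>

lemma exists_gevrey_cutoff:
  assumes "1 < s" "0 < a" "a < (b::real)"
  obtains \<phi> where "deriv_seq {0<..} \<phi>" "gevrey_bound s {0<..} \<phi>"
    "\<And>t k. 0 < t \<Longrightarrow> t \<le> a \<Longrightarrow> \<phi> k t = (if k = 0 then 1 else 0)"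
    "\<And>t k. b \<le> t \<Longrightarrow> \<phi> k t = 0"
proof -
  obtain \<psi> where \<psi>: "deriv_seq UNIV \<psi>" "gevrey_bound s UNIV \<psi>"
    "\<And>k t. t \<le> a \<or> b \<le> t \<Longrightarrow> \<psi> k t = 0" "\<And>t. a < t \<Longrightarrow> t < b \<Longrightarrow> 0 < \<psi> 0 t"
    using exists_gevrey_bump[OF assms(1,3)] by metis
  have nonneg: "0 \<le> \<psi> 0 t" for t
    using \<psi>(3)[of t 0] \<psi>(4)[of t] by (cases "t \<le> a \<or> b \<le> t") auto
  have cont: "continuous_on S (\<psi> 0)" for S
    using deriv_seq_continuous[OF \<psi>(1)] continuous_on_subset by blast
  note int = integrable_continuous_real[OF cont]
  define c where "c = integral {0..b} (\<psi> 0)"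
  have "c \<noteq> 0"
  proof
    assume "c = 0"
    have "\<psi> 0 ((a + b) / 2) = 0"
      using integral_eq_0_iff[of 0 b "\<psi> 0"] cont nonneg assms \<open>c = 0\<close> by (auto simp: c_def)
    with \<psi>(4)[of "(a + b) / 2"] assms show False by (simp add: field_simps)
  qed
  moreover have "c \<ge> 0" unfolding c_def by (intro integral_nonneg int nonneg)
  ultimately have c: "c > 0" by simp
  have zero: "integral {0..t} (\<psi> 0) = 0" if "t \<le> a" for t
    using that \<psi>(3) by (subst integral_cong[where g = "\<lambda>_. 0"]) auto
  have full: "integral {0..t} (\<psi> 0) = c" if "b \<le> t" for t
  proof -
    have "integral {0..b} (\<psi> 0) + integral {b..t} (\<psi> 0) = integral {0..t} (\<psi> 0)"
      using that assms by (intro Henstock_Kurzweil_Integration.integral_combine int) auto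
    moreover have "integral {b..t} (\<psi> 0) = 0"
      using \<psi>(3) by (subst integral_cong[where g = "\<lambda>_. 0"]) auto
    ultimately show ?thesis by (simp add: c_def)
  qed
  define \<phi> where "\<phi> k t = (case k of 0 \<Rightarrow> 1 - integral {0..t} (\<psi> 0) / c | Suc j \<Rightarrow> - \<psi> j t / c)" for k t
  show ?thesis
  proof (rule that[of \<phi>])
    show "deriv_seq {0<..} \<phi>"
      unfolding deriv_seq_def
    proof (intro allI ballI)
      fix k and t :: real assume "t \<in> {0<..}"
      then have t: "0 < t" by simp
      show "(\<phi> k has_real_derivative \<phi> (Suc k) t) (at t)"
      proof (cases k)
        case 0
        have "((\<lambda>t. integral {0..t} (\<psi> 0)) has_real_derivative \<psi> 0 t) (at t within {0..t+1})"
          using t by (intro integral_has_real_derivative cont) auto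
        then have "((\<lambda>t. integral {0..t} (\<psi> 0)) has_real_derivative \<psi> 0 t) (at t)"
          using t by (simp add: at_within_Icc_at)
        then have "((\<lambda>t. 1 - integral {0..t} (\<psi> 0) / c) has_real_derivative - \<psi> 0 t / c) (at t)"
          using c by (auto intro!: derivative_eq_intros)
        then show ?thesis
          using 0 by (simp add: \<phi>_def[abs_def])
      next
        case (Suc j)
        have "((\<lambda>t. - \<psi> j t / c) has_real_derivative - \<psi> (Suc j) t / c) (at t)"
          using c by (auto intro!: derivative_eq_intros deriv_seqD[OF \<psi>(1)])
        then show ?thesis
          using Suc by (simp add: \<phi>_def[abs_def])
      qed
    qed
    show "\<phi> k t = (if k = 0 then 1 else 0)" if "0 < t" "t \<le> a" for t k
      using that zero \<psi>(3) by (auto simp: \<phi>_def split: nat.splits)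
    show "\<phi> k t = 0" if "b \<le> t" for t k
      using that full \<psi>(3) c by (auto simp: \<phi>_def split: nat.splits)
    obtain M R where MR: "0 < M" "1 \<le> R" "\<And>t k. \<bar>\<psi> k t\<bar> \<le> M * fact k powr s * R ^ k"
      using gevrey_boundE[OF \<psi>(2)] by (metis UNIV_I)
    have "\<bar>\<phi> k t\<bar> \<le> (1 + M / c) * fact k powr s * R ^ k" if "0 < t" for k t
    proof (cases k)
      case 0
      have "integral {0..t} (\<psi> 0) \<le> c"
      proof (cases "t \<le> b")
        case True
        then show ?thesis unfolding c_def by (intro integral_subset_le int) (auto simp: nonneg)
      qed (simp add: full)
      moreover have "0 \<le> integral {0..t} (\<psi> 0)" by (intro integral_nonneg int nonneg)
      ultimately have "\<bar>\<phi> 0 t\<bar> \<le> 1" using c by (simp add: \<phi>_def field_simps)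
      also have "1 \<le> 1 + M / c" using MR c by simp
      finally show ?thesis using 0 by simp
    next
      case (Suc j)
      have "\<bar>\<phi> k t\<bar> = \<bar>\<psi> j t\<bar> / c" using c Suc by (simp add: \<phi>_def)
      also have "\<dots> \<le> (M * fact j powr s * R ^ j) / c"
        using c by (intro divide_right_mono MR) auto
      also have "\<dots> = M / c * fact j powr s * R ^ j" by simp
      \<comment> \<open>The shift \<open>k = Suc j\<close> costs nothing, since
        \<open>fact j \<le> fact k\<close> and \<open>R ^ j \<le> R ^ k\<close> for
        \<open>R \<ge> 1\<close>.\<close>
      also have "\<dots> \<le> (1 + M / c) * fact k powr s * R ^ k"
        using MR c assms(1) Suc
        by (intro mult_mono powr_mono2 power_increasing fact_mono) auto
      finally show ?thesis .
    qed
    then show "gevrey_bound s {0<..} \<phi>"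
      using MR c unfolding gevrey_bound_def
      by (intro exI[of _ "1 + M / c"] exI[of _ R] conjI) (auto intro: add_pos_pos)
  qed
qed

section \<open>From derivative sequences to \<open>gevrey_on_interval\<close>\<close>

lemma vector_derivative_within_eqI:
  assumes "(a::real) < b" "t \<in> {a..b}" "\<And>r. r \<in> {a..b} \<Longrightarrow> g r = f r"
    and "(f has_real_derivative D) (at t within {a..b})"
  shows "vector_derivative g (at t within {a..b}) = D" "g differentiable (at t within {a..b})"
proof -
  have "(f has_vector_derivative D) (at t within {a..b})"
    using assms(4) by (simp add: has_real_derivative_iff_has_vector_derivative)
  then have g: "(g has_vector_derivative D) (at t within {a..b})"
    by (rule has_vector_derivative_transform[rotated 2]) (use assms in auto)
  then show "vector_derivative g (at t within {a..b}) = D"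
    using assms by (intro vector_derivative_within_closed_interval) auto
  from g show "g differentiable (at t within {a..b})"
    by (rule differentiableI_vector)
qed

text \<open>Induction on k. Agreement with \<open>f k\<close> is known on \<open>{a..b}\<close>
  only, which is enough because a derivative within that interval does not see other points.\<close>

lemma deriv_on_eq:
  assumes "a < b" and f: "\<And>k t. t \<in> {a..b} \<Longrightarrow> (f k has_real_derivative f (Suc k) t) (at t within {a..b})"
    and y: "\<And>t. t \<in> {a..b} \<Longrightarrow> y t = f 0 t" and "t \<in> {a..b}"
  shows "deriv_on a b k y t = f k t"
  using assms(4)
proof (induction k arbitrary: t)
  case 0
  then show ?case by (simp add: deriv_on_def y)
next
  case (Suc k)
  have "vector_derivative (deriv_on a b k y) (at t within {a..b}) = f (Suc k) t"
    by (rule vector_derivative_within_eqI(1)[where f = "f k"]) (use assms(1) Suc f in auto)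
  then show ?case by (simp add: deriv_on_def)
qed

lemma gevrey_on_intervalI:
  assumes "a < b" and f: "\<And>k t. t \<in> {a..b} \<Longrightarrow> (f k has_real_derivative f (Suc k) t) (at t within {a..b})"
    and y: "\<And>t. t \<in> {a..b} \<Longrightarrow> y t = f 0 t" and g: "gevrey_bound s {a..b} f"
  shows "gevrey_on_interval s a b y"
proof -
  have eq: "deriv_on a b k y t = f k t" if "t \<in> {a..b}" for k t
    by (rule deriv_on_eq[where f = f]) (use that assms in auto)
  obtain M R where MR: "0 < M" "1 \<le> R" "\<And>t k. t \<in> {a..b} \<Longrightarrow> \<bar>f k t\<bar> \<le> M * fact k powr s * R ^ k"
    using gevrey_boundE[OF g] by metis
  have "smooth_on_interval a b y"
    unfolding smooth_on_interval_def
  proof (intro allI ballI)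
    show "deriv_on a b p y differentiable (at t within {a..b})" if "t \<in> {a..b}" for p t
      by (rule vector_derivative_within_eqI(2)[where f = "f p"]) (use assms(1) that eq f in auto)
  qed
  moreover have "\<bar>deriv_on a b p y t\<bar> \<le> M * fact p powr s / (1 / R) ^ p" if "t \<in> {a..b}" for t p
    using MR(3)[OF that, of p] by (simp add: eq[OF that] power_divide)
  ultimately show ?thesis
    using MR unfolding gevrey_on_interval_def
    by (intro conjI exI[of _ M] exI[of _ "1 / R"]) auto
qed

section \<open>The flat series solution\<close>

lemma fact_add_le: "fact (m + n) \<le> (2 ^ (m + n) * fact m * fact n :: real)"
proof -
  have "(m + n) choose m \<le> (\<Sum>j\<le>m + n. (m + n) choose j)"
    by (intro member_le_sum) auto
  then have "real ((m + n) choose m) \<le> 2 ^ (m + n)"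
    by (simp only: choose_row_sum) (metis of_nat_le_iff of_nat_numeral of_nat_power)
  moreover have "real ((m + n) choose m) = fact (m + n) / (fact m * fact n)"
    by (simp add: binomial_fact)
  ultimately show ?thesis by (simp add: field_simps)
qed

text \<open>Used with \<open>a = s / 2\<close>: up to a geometric factor, it separates the order of
  a derivative from the summation index.\<close>

lemma fact_add_powr_le:
  fixes a :: real
  assumes "0 \<le> a" "a \<le> 1"
  shows "fact (m + n) powr a \<le> 2 ^ (m + n) * fact m powr a * fact n powr a"
proof -
  have "fact (m + n) powr a \<le> (2 ^ (m + n) * fact m * fact n) powr a"
    using assms by (intro powr_mono2 fact_add_le) auto
  also have "\<dots> = (2 ^ (m + n)) powr a * fact m powr a * fact n powr a"
    by (simp add: powr_mult)
  also have "\<dots> \<le> (2 ^ (m + n)) powr 1 * fact m powr a * fact n powr a"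
    using assms by (intro mult_right_mono powr_mono) auto
  finally show ?thesis by simp
qed

text \<open>A positive power of the factorial outgrows every geometric sequence. It is used with
  \<open>\<sigma> = 1 - s / 2\<close>, which is positive because \<open>s < 2\<close>.\<close>

lemma summable_power_over_fact_powr:
  fixes A \<sigma> :: real
  assumes "0 < A" "0 < \<sigma>"
  shows "summable (\<lambda>n. A ^ n / fact n powr \<sigma>)"
\<comment> \<open>From this index on \<open>real (Suc n) powr \<sigma> \<ge> 2 * A\<close>, so
  consecutive terms at least halve.\<close>
proof (rule summable_ratio_test[where c = "1/2" and N = "nat \<lceil>(2 * A) powr (1 / \<sigma>)\<rceil>"])
  fix n assume "nat \<lceil>(2 * A) powr (1 / \<sigma>)\<rceil> \<le> n"
  then have "(2 * A) powr (1 / \<sigma>) \<le> real (Suc n)" by linarith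
  then have "((2 * A) powr (1 / \<sigma>)) powr \<sigma> \<le> real (Suc n) powr \<sigma>"
    using assms by (intro powr_mono2) auto
  then have "2 * A \<le> real (Suc n) powr \<sigma>"
    using assms by (simp add: powr_powr)
  then have "A / real (Suc n) powr \<sigma> \<le> 1 / 2"
    by (simp add: field_simps)
  then have "A / real (Suc n) powr \<sigma> * (A ^ n / fact n powr \<sigma>) \<le> 1 / 2 * (A ^ n / fact n powr \<sigma>)"
    using assms by (intro mult_right_mono) auto
  moreover have "A ^ Suc n / fact (Suc n) powr \<sigma> = A / real (Suc n) powr \<sigma> * (A ^ n / fact n powr \<sigma>)"
    by (simp add: powr_mult)
  ultimately show "norm (A ^ Suc n / fact (Suc n) powr \<sigma>) \<le> 1 / 2 * norm (A ^ n / fact n powr \<sigma>)"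
    using assms by (simp only: real_norm_def) simp
qed simp

lemma fact_square_le: "(fact n)\<^sup>2 \<le> (fact (2 * n) :: real)"
proof -
  have "fact n * fact n dvd (fact (n + n) :: nat)"
    by (rule fact_fact_dvd_fact)
  then have "fact n * fact n \<le> (fact (n + n) :: nat)"
    by (rule dvd_imp_le) simp
  then show ?thesis
    by (metis mult_2 of_nat_fact of_nat_le_iff of_nat_mult power2_eq_square)
qed

text \<open>Odd coefficients are padded with zeros, so that differentiating the series in x shifts
  the index by 1 and differentiating in t shifts it by 2. All mixed derivatives then lie in the one
  family \<open>flat_series Y q\<close>.\<close>

definition even_coeff :: "(nat \<Rightarrow> real \<Rightarrow> real) \<Rightarrow> nat \<Rightarrow> real \<Rightarrow> real" where
  "even_coeff Y m t = (if even m then Y (m div 2) t else 0)"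

text \<open>For a smooth function with derivatives \<open>Y\<close>, \<open>flat_series Y 0\<close> is the formal solution
  \<open>\<Sum> Y i t * x\<^bsup>2i\<^esup> / (2i)!\<close> of the heat equation with \<open>\<theta>(t,0) = Y 0 t\<close> and
  \<open>\<theta>\<^sub>x(t,0) = 0\<close>, and \<open>flat_series Y q\<close> is its \<open>q\<close>-th derivative in \<open>x\<close>.\<close>

definition flat_series :: "(nat \<Rightarrow> real \<Rightarrow> real) \<Rightarrow> nat \<Rightarrow> real \<Rightarrow> real \<Rightarrow> real" where
  "flat_series Y q t x = (\<Sum>n. even_coeff Y (n + q) t / fact n * x ^ n)"

text \<open>The bounds are asked for on \<open>{\<epsilon>..}\<close>, with constants depending on
  \<open>\<epsilon>\<close>, because a trace that comes from square integrable data may blow up at t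
  = 0.\<close>

locale flat_output =
  fixes Y :: "nat \<Rightarrow> real \<Rightarrow> real" and s :: real
  assumes Y: "deriv_seq {0<..} Y"
    and Y_bound: "0 < \<epsilon> \<Longrightarrow> gevrey_bound s {\<epsilon>..} Y"
    and s: "0 \<le> s" "s < 2"
begin

lemma even_coeff_deriv:
  assumes "0 < t"
  shows "(even_coeff Y m has_real_derivative even_coeff Y (m + 2) t) (at t)"
  using deriv_seqD[OF Y, of t "m div 2"] assms
  by (auto simp: even_coeff_def[abs_def])

text \<open>At \<open>m = 2 * k\<close> the bound rests on
  \<open>(fact k)\<^sup>2 \<le> fact (2 * k)\<close> raised to the power \<open>s / 2\<close>: order
  s in k becomes order s/2 in m.\<close>

lemma even_coeff_bound:
  assumes "0 < \<epsilon>"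
  obtains M R where "0 < M" "1 \<le> R"
    "\<And>t m. \<epsilon> \<le> t \<Longrightarrow> \<bar>even_coeff Y m t\<bar> \<le> M * fact m powr (s / 2) * R ^ m"
proof -
  obtain M R where MR: "0 < M" "1 \<le> R" "\<And>t k. t \<in> {\<epsilon>..} \<Longrightarrow> \<bar>Y k t\<bar> \<le> M * fact k powr s * R ^ k"
    using gevrey_boundE[OF Y_bound[OF assms]] by metis
  have "\<bar>even_coeff Y m t\<bar> \<le> M * fact m powr (s / 2) * R ^ m" if "\<epsilon> \<le> t" for t m
  proof (cases "even m")
    case True
    then obtain k where k: "m = 2 * k" by auto
    have "fact k powr s = ((fact k)\<^sup>2) powr (s / 2)"
      by (simp add: powr_powr flip: powr_numeral)
    also have "\<dots> \<le> fact m powr (s / 2)"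
      using s unfolding k by (intro powr_mono2 fact_square_le) auto
    finally have "M * fact k powr s * R ^ k \<le> M * fact m powr (s / 2) * R ^ m"
      using MR k by (intro mult_mono power_increasing) auto
    moreover have "\<bar>even_coeff Y m t\<bar> \<le> M * fact k powr s * R ^ k"
      using MR(3)[of t k] that k by (simp add: even_coeff_def)
    ultimately show ?thesis by linarith
  qed (use MR in \<open>simp add: even_coeff_def\<close>)
  with MR show ?thesis by (intro that) auto
qed

text \<open>One summable \<open>w\<close> serves all derivative orders:
  \<open>fact_add_powr_le\<close> splits \<open>fact (n + q) powr (s / 2)\<close>, the q-part is
  pulled out, and the n-part divided by \<open>fact n\<close> leaves
  \<open>fact n powr (1 - s / 2)\<close> in the denominator. Convergence, bounds and continuity of
  the series all come from here.\<close>

lemma flat_series_majorant: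
  assumes "0 < \<epsilon>"
  obtains A w where "1 \<le> A" "summable w" "\<And>n. 0 \<le> w n"
    "\<And>q n t x. \<epsilon> \<le> t \<Longrightarrow> \<bar>x\<bar> \<le> X \<Longrightarrow>
       \<bar>even_coeff Y (n + q) t / fact n * x ^ n\<bar> \<le> fact q powr (s / 2) * A ^ q * w n"
proof -
  obtain M R where MR: "0 < M" "1 \<le> R"
    "\<And>t m. \<epsilon> \<le> t \<Longrightarrow> \<bar>even_coeff Y m t\<bar> \<le> M * fact m powr (s / 2) * R ^ m"
    using even_coeff_bound[OF assms] by metis
  define X' where "X' = max 1 X"
  have X': "1 \<le> X'" "X \<le> X'" by (auto simp: X'_def)
  define w where "w n = M * ((2 * R * X') ^ n / fact n powr (1 - s / 2))" for n
  show ?thesis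
  \<comment> \<open>The 2 is the geometric price of splitting the factorial.\<close>
  proof (rule that[of "2 * R" w])
    show "1 \<le> 2 * R" using MR by simp
    show "summable w"
      unfolding w_def using MR X' s by (intro summable_mult summable_power_over_fact_powr) auto
    show "0 \<le> w n" for n using MR X' by (simp add: w_def)
    fix q n and t x :: real assume t: "\<epsilon> \<le> t" and x: "\<bar>x\<bar> \<le> X"
    have "\<bar>even_coeff Y (n + q) t / fact n * x ^ n\<bar> = \<bar>even_coeff Y (n + q) t\<bar> / fact n * \<bar>x\<bar> ^ n"
      by (simp add: abs_mult power_abs)
    also have "\<dots> \<le> (M * fact (n + q) powr (s / 2) * R ^ (n + q)) / fact n * X' ^ n"
      using x X' MR(1,2) by (intro mult_mono divide_right_mono MR(3)[OF t] power_mono) auto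
    also have "\<dots> \<le> (M * (2 ^ (n + q) * fact n powr (s / 2) * fact q powr (s / 2)) * R ^ (n + q)) / fact n * X' ^ n"
      using X' MR s by (intro mult_right_mono divide_right_mono mult_left_mono fact_add_powr_le) auto
    also have "\<dots> = fact q powr (s / 2) * (2 * R) ^ q * w n"
      by (simp add: w_def powr_diff power_add power_mult_distrib)
    finally show "\<bar>even_coeff Y (n + q) t / fact n * x ^ n\<bar> \<le> fact q powr (s / 2) * (2 * R) ^ q * w n" .
  qed
qed

lemma summable_flat_series:
  assumes "0 < t"
  shows "summable (\<lambda>n. even_coeff Y (n + q) t / fact n * x ^ n)"
proof -
  obtain A w where Aw: "1 \<le> A" "summable w" "\<And>n. 0 \<le> w n"
    "\<And>q n r x'. t \<le> r \<Longrightarrow> \<bar>x'\<bar> \<le> \<bar>x\<bar> \<Longrightarrow>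
       \<bar>even_coeff Y (n + q) r / fact n * x' ^ n\<bar> \<le> fact q powr (s / 2) * A ^ q * w n"
    using flat_series_majorant[OF assms, of "\<bar>x\<bar>"] by metis
  show ?thesis
    by (rule summable_comparison_test'[of "\<lambda>n. fact q powr (s / 2) * A ^ q * w n" 0])
       (use Aw in \<open>auto intro!: summable_mult\<close>)
qed

lemma flat_series_bound:
  assumes "0 < \<epsilon>"
  obtains A W where "1 \<le> A" "0 < W"
    "\<And>q t x. \<epsilon> \<le> t \<Longrightarrow> \<bar>x\<bar> \<le> X \<Longrightarrow> \<bar>flat_series Y q t x\<bar> \<le> W * fact q powr (s / 2) * A ^ q"
proof -
  obtain A w where Aw: "1 \<le> A" "summable w" "\<And>n. 0 \<le> w n"
    "\<And>q n t x. \<epsilon> \<le> t \<Longrightarrow> \<bar>x\<bar> \<le> X \<Longrightarrow>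
       \<bar>even_coeff Y (n + q) t / fact n * x ^ n\<bar> \<le> fact q powr (s / 2) * A ^ q * w n"
    using flat_series_majorant[OF assms, of X] by metis
  show ?thesis
  proof (rule that[OF Aw(1), of "1 + suminf w"])
    show "0 < 1 + suminf w" using suminf_nonneg[OF Aw(2,3)] by simp
    fix q and t x :: real assume *: "\<epsilon> \<le> t" "\<bar>x\<bar> \<le> X"
    have "\<bar>flat_series Y q t x\<bar> \<le> (\<Sum>n. fact q powr (s / 2) * A ^ q * w n)"
      unfolding flat_series_def real_norm_def[symmetric]
      by (rule norm_suminf_le) (use Aw * in \<open>auto intro!: summable_mult\<close>)
    also have "\<dots> = fact q powr (s / 2) * A ^ q * suminf w"
      using Aw(2) by (rule suminf_mult)
    also have "\<dots> \<le> fact q powr (s / 2) * A ^ q * (1 + suminf w)"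
      using Aw(1) by (intro mult_left_mono) auto
    finally show "\<bar>flat_series Y q t x\<bar> \<le> (1 + suminf w) * fact q powr (s / 2) * A ^ q"
      by (simp add: mult_ac)
  qed
qed

lemma flat_series_deriv_x:
  assumes "0 < t"
  shows "(flat_series Y q t has_real_derivative flat_series Y (Suc q) t x) (at x)"
proof -
  have "((\<lambda>x. \<Sum>n. even_coeff Y (n + q) t / fact n * x ^ n) has_real_derivative
     (\<Sum>n. diffs (\<lambda>n. even_coeff Y (n + q) t / fact n) n * x ^ n)) (at x)"
    by (rule termdiffs_strong_converges_everywhere) (rule summable_flat_series[OF assms])
  moreover have "diffs (\<lambda>n. even_coeff Y (n + q) t / fact n) n = even_coeff Y (n + Suc q) t / fact n" for n
    by (simp add: diffs_def del: of_nat_Suc)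
  ultimately show ?thesis
    by (simp add: flat_series_def[abs_def])
qed

text \<open>Termwise differentiation on \<open>{t/2..}\<close>, a half line with t in its interior
  on which the majorant is available. Each coefficient moves two places, which is the heat
  equation.\<close>

lemma flat_series_deriv_t:
  assumes "0 < t"
  shows "((\<lambda>t. flat_series Y q t x) has_real_derivative flat_series Y (q + 2) t x) (at t)"
proof -
  obtain A w where Aw: "1 \<le> A" "summable w" "\<And>n. 0 \<le> w n"
    "\<And>q n r x'. t / 2 \<le> r \<Longrightarrow> \<bar>x'\<bar> \<le> \<bar>x\<bar> \<Longrightarrow>
       \<bar>even_coeff Y (n + q) r / fact n * x' ^ n\<bar> \<le> fact q powr (s / 2) * A ^ q * w n"
    using flat_series_majorant[of "t / 2" "\<bar>x\<bar>"] assms by (metis half_gt_zero)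
  have "((\<lambda>r. \<Sum>n. even_coeff Y (n + q) r / fact n * x ^ n) has_real_derivative
     (\<Sum>n. even_coeff Y (n + (q + 2)) t / fact n * x ^ n)) (at t)"
  proof (rule has_field_derivative_series'(2))
    show "convex {t/2..}" by simp
    show "uniformly_convergent_on {t/2..} (\<lambda>n r. \<Sum>i<n. even_coeff Y (i + (q + 2)) r / fact i * x ^ i)"
    proof (rule Weierstrass_m_test'[where M = "\<lambda>n. fact (q + 2) powr (s / 2) * A ^ (q + 2) * w n"])
      show "norm (even_coeff Y (n + (q + 2)) r / fact n * x ^ n) \<le> fact (q + 2) powr (s / 2) * A ^ (q + 2) * w n"
        if "r \<in> {t/2..}" for n r
        using Aw(4)[of r x n "q + 2"] that by (simp only: real_norm_def) simp
    qed (intro summable_mult Aw)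
    show "t \<in> {t/2..}" "t \<in> interior {t/2..}" using assms by auto
    show "summable (\<lambda>n. even_coeff Y (n + q) t / fact n * x ^ n)"
      by (rule summable_flat_series[OF assms])
    fix n r assume "r \<in> {t/2..}"
    then have "0 < r" using assms by auto
    from even_coeff_deriv[OF this, of "n + q"]
    have "((\<lambda>r. even_coeff Y (n + q) r / fact n * x ^ n) has_real_derivative even_coeff Y (n + q + 2) r / fact n * x ^ n) (at r)"
      by (intro DERIV_cmult_right DERIV_cdivide)
    then show "((\<lambda>r. even_coeff Y (n + q) r / fact n * x ^ n) has_real_derivative even_coeff Y (n + (q + 2)) r / fact n * x ^ n) (at r within {t/2..})"
      by (simp add: has_field_derivative_at_within add.assoc)
  qed
  then show ?thesis by (simp add: flat_series_def)
qed

lemma flat_series_isCont: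
  assumes "0 < t"
  shows "isCont (\<lambda>z. flat_series Y q (fst z) (snd z)) (t, x)"
proof -
  obtain A w where Aw: "1 \<le> A" "summable w" "\<And>n. 0 \<le> w n"
    "\<And>q n r x'. t / 2 \<le> r \<Longrightarrow> \<bar>x'\<bar> \<le> \<bar>x\<bar> + 1 \<Longrightarrow>
       \<bar>even_coeff Y (n + q) r / fact n * x' ^ n\<bar> \<le> fact q powr (s / 2) * A ^ q * w n"
    using flat_series_majorant[of "t / 2" "\<bar>x\<bar> + 1"] assms by (metis half_gt_zero)
  \<comment> \<open>An open set that is bounded in x and stays away from time 0, so the majorant is
    uniform on it.\<close>
  define S where "S = {t/2<..} \<times> {-(\<bar>x\<bar> + 1)<..<\<bar>x\<bar> + 1}"
  have "continuous_on S (\<lambda>z. \<Sum>n. even_coeff Y (n + q) (fst z) / fact n * snd z ^ n)"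
  proof (rule uniform_limit_theorem)
    show "uniform_limit S (\<lambda>n z. \<Sum>i<n. even_coeff Y (i + q) (fst z) / fact i * snd z ^ i)
        (\<lambda>z. \<Sum>n. even_coeff Y (n + q) (fst z) / fact n * snd z ^ n) sequentially"
      by (rule Weierstrass_m_test[where M = "\<lambda>n. fact q powr (s / 2) * A ^ q * w n"])
         (use Aw in \<open>auto intro!: summable_mult simp: S_def\<close>)
    have "continuous_on {0<..} (even_coeff Y m)" for m
      by (intro continuous_at_imp_continuous_on ballI DERIV_isCont[OF even_coeff_deriv]) simp
    then have "continuous_on S (\<lambda>z. even_coeff Y m (fst z))" for m
      using assms by (intro continuous_on_compose2[of "{0<..}" "even_coeff Y m" S fst])
         (auto simp: S_def intro!: continuous_intros)
    then show "\<forall>\<^sub>F n in sequentially. continuous_on S (\<lambda>z. \<Sum>i<n. even_coeff Y (i + q) (fst z) / fact i * snd z ^ i)"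
      by (intro always_eventually allI continuous_intros) auto
  qed simp
  moreover have "open S" unfolding S_def by (intro open_Times) auto
  moreover have "(t, x) \<in> S" using assms by (auto simp: S_def)
  ultimately show ?thesis
    by (simp add: continuous_on_eq_continuous_at flat_series_def)
qed

text \<open>Two partial derivatives give a total one when one of them is continuous in both
  variables; \<open>flat_series_isCont\<close> provides this for the x-derivative.\<close>

lemma flat_series_has_derivative:
  assumes "0 < fst z"
  shows "((\<lambda>z. flat_series Y q (fst z) (snd z)) has_derivative
     (\<lambda>h. fst h * flat_series Y (q + 2) (fst z) (snd z) + snd h * flat_series Y (Suc q) (fst z) (snd z))) (at z)"
proof -
  obtain t x where z: "z = (t, x)" by (cases z)
  with assms have t: "0 < t" by simp
  have "((\<lambda>(t, x). flat_series Y q t x) has_derivative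
      (\<lambda>(h, k). h * flat_series Y (q + 2) t x + blinfun_scaleR_left (flat_series Y (Suc q) t x) k))
      (at (t, x) within {0<..} \<times> UNIV)"
  proof (rule has_derivative_partialsI[where fy = "\<lambda>t x. blinfun_scaleR_left (flat_series Y (Suc q) t x)"])
    show "((\<lambda>t. flat_series Y q t x) has_derivative (\<lambda>h. h * flat_series Y (q + 2) t x)) (at t within {0<..})"
      using flat_series_deriv_t[OF t, of q x]
      unfolding has_field_derivative_def mult_commute_abs by (rule has_derivative_at_withinI)
    show "(flat_series Y q t has_derivative blinfun_apply (blinfun_scaleR_left (flat_series Y (Suc q) t x))) (at x within UNIV)"
      if "t \<in> {0<..}" for t x
      using flat_series_deriv_x[of t q x] that
      by (simp add: has_field_derivative_def blinfun_scaleR_left.rep_eq mult_commute_abs)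
    have "isCont (\<lambda>z. blinfun_scaleR_left (flat_series Y (Suc q) (fst z) (snd z))) (t, x)"
      by (intro bounded_linear.continuous[OF bounded_linear_blinfun_scaleR_left] flat_series_isCont t)
    then show "continuous (at (t, x) within {0<..} \<times> UNIV) (\<lambda>(t, x). blinfun_scaleR_left (flat_series Y (Suc q) t x))"
      by (simp add: case_prod_unfold continuous_at_imp_continuous_at_within)
  qed auto
  moreover have "at (t, x) within {0<..} \<times> UNIV = at (t, x)"
    using t by (intro at_within_open open_Times) auto
  ultimately show ?thesis
    by (simp add: z case_prod_unfold blinfun_scaleR_left.rep_eq)
qed

text \<open>\<open>F\<close> is only assumed to agree with the series on the open half plane, so
  that the lemma applies again to the partial derivatives, whose values elsewhere are
  unknown.\<close>

lemma partial_flat_series: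
  assumes F: "\<And>z. 0 < fst z \<Longrightarrow> F z = flat_series Y q (fst z) (snd z)" and z: "0 < fst z"
  shows "F differentiable (at z)"
    and "partial (1, 0) F z = flat_series Y (q + 2) (fst z) (snd z)"
    and "partial (0, 1) F z = flat_series Y (Suc q) (fst z) (snd z)"
proof -
  have "open (({0<..} :: real set) \<times> (UNIV :: real set))" by (intro open_Times) auto
  then have "(F has_derivative
     (\<lambda>h. fst h * flat_series Y (q + 2) (fst z) (snd z) + snd h * flat_series Y (Suc q) (fst z) (snd z))) (at z)"
    by (rule has_derivative_transform_within_open[OF flat_series_has_derivative[OF z, of q]])
       (use z F in \<open>auto simp: mem_Times_iff\<close>)
  note D = this frechet_derivative_at[OF this, symmetric]
  show "F differentiable (at z)" using D(1) differentiable_def by blast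
  show "partial (1, 0) F z = flat_series Y (q + 2) (fst z) (snd z)"
    "partial (0, 1) F z = flat_series Y (Suc q) (fst z) (snd z)"
    by (simp_all add: partial_def D(2))
qed

lemma Ck_on_flat_series:
  assumes "\<And>z. 0 < fst z \<Longrightarrow> F z = flat_series Y q (fst z) (snd z)"
  shows "Ck_on k ({0<..} \<times> UNIV) F"
  using assms
proof (induction k arbitrary: F q)
  case 0
  then have "continuous_on ({0<..} \<times> UNIV) F"
    by (intro differentiable_imp_continuous_on differentiable_at_imp_differentiable_on)
       (auto intro: partial_flat_series(1))
  then show ?case by simp
next
  case (Suc k)
  have "Ck_on k ({0<..} \<times> UNIV) (partial (1, 0) F)"
    by (rule Suc.IH[of _ "q + 2"]) (rule partial_flat_series(2)[OF Suc.prems])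
  moreover have "Ck_on k ({0<..} \<times> UNIV) (partial (0, 1) F)"
    by (rule Suc.IH[of _ "Suc q"]) (rule partial_flat_series(3)[OF Suc.prems])
  ultimately show ?case
    using Suc.prems by (auto simp: Basis_prod_def intro: partial_flat_series(1))
qed

lemma iterated_partial_flat_series:
  assumes "0 < fst z"
  shows "((partial (1, 0) ^^ p) ((partial (0, 1) ^^ q) (\<lambda>z. flat_series Y 0 (fst z) (snd z)))) z
    = flat_series Y (q + 2 * p) (fst z) (snd z)"
proof -
  let ?F = "\<lambda>z. flat_series Y 0 (fst z) (snd z)"
  have x: "((partial (0, 1) ^^ q) ?F) z = flat_series Y q (fst z) (snd z)" if "0 < fst z" for z q
    using that
  proof (induction q arbitrary: z)
    case (Suc q)
    show ?case
      using partial_flat_series(3)[of "(partial (0, 1) ^^ q) ?F" q z] Suc by simp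
  qed simp
  show ?thesis using assms
  proof (induction p arbitrary: z)
    case 0
    then show ?case using x by simp
  next
    case (Suc p)
    show ?case
      using partial_flat_series(2)[of "(partial (1, 0) ^^ p) ((partial (0, 1) ^^ q) ?F)" "q + 2 * p" z] Suc
      by simp
  qed
qed

text \<open>Splitting \<open>q + 2 * p\<close> puts order s/2 on the q space derivatives; as
  \<open>fact (2 * p)\<close> splits once more into two equal factors, the p time derivatives
  receive the full order s. The 16 collects \<open>2 ^ (2 * p)\<close> twice.\<close>

lemma fact_add_double_powr_le:
  "fact (q + 2 * p) powr (s / 2) \<le> 2 ^ q * fact q powr (s / 2) * (16 ^ p * fact p powr s)"
proof -
  have "fact (q + 2 * p) powr (s / 2) \<le> 2 ^ (q + 2 * p) * fact q powr (s / 2) * fact (2 * p) powr (s / 2)"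
    using s by (intro fact_add_powr_le) auto
  also have "fact (2 * p) powr (s / 2) \<le> 2 ^ (2 * p) * fact p powr (s / 2) * fact p powr (s / 2)"
    using s fact_add_powr_le[of "s / 2" p p] by (simp add: mult_2)
  also have "2 ^ (q + 2 * p) * fact q powr (s / 2) * (2 ^ (2 * p) * fact p powr (s / 2) * fact p powr (s / 2))
      = (2 ^ (q + 2 * p) * 2 ^ (2 * p)) * fact q powr (s / 2) * (fact p powr (s / 2) * fact p powr (s / 2))"
    by (simp only: mult_ac)
  also have "2 ^ (q + 2 * p) * 2 ^ (2 * p) = 2 ^ q * (16 ^ p :: real)"
    by (simp add: power_add power_mult flip: power_mult_distrib)
  also have "fact p powr (s / 2) * fact p powr (s / 2) = fact p powr s"
    by (simp flip: powr_add)
  finally show ?thesis by (simp add: mult_ac)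
qed

lemma gevrey_on_plane_flat_series:
  assumes "0 < \<epsilon>"
  shows "gevrey_on_plane s (s / 2) ({\<epsilon>..T} \<times> {0..1}) (\<lambda>z. flat_series Y 0 (fst z) (snd z))"
proof -
  let ?F = "\<lambda>z. flat_series Y 0 (fst z) (snd z)"
  obtain A W where AW: "1 \<le> A" "0 < W"
    "\<And>q t x. \<epsilon> \<le> t \<Longrightarrow> \<bar>x\<bar> \<le> 1 \<Longrightarrow> \<bar>flat_series Y q t x\<bar> \<le> W * fact q powr (s / 2) * A ^ q"
    using flat_series_bound[OF assms, of 1] by metis
  have bound: "\<bar>(partial (1, 0) ^^ p) ((partial (0, 1) ^^ q) ?F) z\<bar>
      \<le> W * (fact p powr s / (1 / (16 * A\<^sup>2)) ^ p) * (fact q powr (s / 2) / (1 / (2 * A)) ^ q)"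
    if z: "z \<in> {\<epsilon>..T} \<times> {0..1}" for z p q
  proof -
    have "0 < fst z" using z assms by auto
    then have "\<bar>(partial (1, 0) ^^ p) ((partial (0, 1) ^^ q) ?F) z\<bar> = \<bar>flat_series Y (q + 2 * p) (fst z) (snd z)\<bar>"
      by (simp add: iterated_partial_flat_series)
    also have "\<dots> \<le> W * fact (q + 2 * p) powr (s / 2) * A ^ (q + 2 * p)"
      using z by (intro AW) auto
    also have "\<dots> \<le> W * (2 ^ q * fact q powr (s / 2) * (16 ^ p * fact p powr s)) * A ^ (q + 2 * p)"
      using AW fact_add_double_powr_le by (intro mult_right_mono mult_left_mono) auto
    also have "\<dots> = W * (fact p powr s / (1 / (16 * A\<^sup>2)) ^ p) * (fact q powr (s / 2) / (1 / (2 * A)) ^ q)"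
      by (simp add: power_add power_mult power_mult_distrib power_divide)
    finally show ?thesis .
  qed
  show ?thesis
    unfolding gevrey_on_plane_def
  proof (rule exI[of _ "{0<..} \<times> UNIV"], rule exI[of _ ?F], intro conjI)
    show "open (({0<..} :: real set) \<times> (UNIV :: real set))" by (intro open_Times) auto
    show "\<exists>M>0. \<exists>R1>0. \<exists>R2>0. \<forall>z\<in>{\<epsilon>..T} \<times> {0..1}. \<forall>p q.
          \<bar>(partial (1, 0) ^^ p) ((partial (0, 1) ^^ q) ?F) z\<bar>
            \<le> M * (fact p powr s / R1 ^ p) * (fact q powr (s / 2) / R2 ^ q)"
      using AW bound
      \<comment> \<open>The radii are reciprocal to the geometric factors
        \<open>16 * A\<^sup>2\<close> and \<open>2 * A\<close> in the estimate above.\<close>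
      by (intro exI[of _ W] exI[of _ "1 / (16 * A\<^sup>2)"] exI[of _ "1 / (2 * A)"] conjI ballI allI) auto
  qed (use assms in \<open>auto intro!: Ck_on_flat_series\<close>)
qed

section \<open>The flux at x = 1 and its time derivatives\<close>

definition boundary_flux :: "nat \<Rightarrow> real \<Rightarrow> real" where
  "boundary_flux k t = flat_series Y (Suc (2 * k)) t 1"

lemma deriv_seq_boundary_flux: "deriv_seq {0<..} boundary_flux"
  unfolding deriv_seq_def
proof (intro allI ballI)
  fix k and t :: real assume "t \<in> {0<..}"
  then show "(boundary_flux k has_real_derivative boundary_flux (Suc k) t) (at t)"
    using flat_series_deriv_t[of t "Suc (2 * k)" 1] by (simp add: boundary_flux_def[abs_def])
qed

lemma gevrey_bound_boundary_flux:
  assumes "0 < \<epsilon>"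
  shows "gevrey_bound s {\<epsilon>..} boundary_flux"
proof -
  obtain A W where AW: "1 \<le> A" "0 < W"
    "\<And>q t x. \<epsilon> \<le> t \<Longrightarrow> \<bar>x\<bar> \<le> 1 \<Longrightarrow> \<bar>flat_series Y q t x\<bar> \<le> W * fact q powr (s / 2) * A ^ q"
    using flat_series_bound[OF assms, of 1] by metis
  have "\<bar>boundary_flux k t\<bar> \<le> 2 * W * A * fact k powr s * (16 * A\<^sup>2) ^ k" if "\<epsilon> \<le> t" for k t
  proof -
    have "\<bar>boundary_flux k t\<bar> \<le> W * fact (1 + 2 * k) powr (s / 2) * A ^ (1 + 2 * k)"
      using AW(3)[of t 1 "Suc (2 * k)"] that by (simp add: boundary_flux_def)
    also have "\<dots> \<le> W * (2 ^ 1 * fact 1 powr (s / 2) * (16 ^ k * fact k powr s)) * A ^ (1 + 2 * k)"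
      using AW fact_add_double_powr_le[of 1 k] by (intro mult_right_mono mult_left_mono) auto
    also have "\<dots> = 2 * W * A * fact k powr s * (16 * A\<^sup>2) ^ k"
      by (simp add: power_add power_mult power_mult_distrib)
    finally show ?thesis .
  qed
  then show ?thesis
    using AW unfolding gevrey_bound_def
    by (intro exI[of _ "2 * W * A"] exI[of _ "16 * A\<^sup>2"] conjI) auto
qed

text \<open>In the first x-derivative only odd n carry a nonzero coefficient. The substitution
  \<open>n = 2 * i + 1\<close> gives \<open>Y (Suc i)\<close> over \<open>fact (2 * i + 1)\<close>,
  and \<open>2 * i + 1\<close> is the \<open>2 * Suc i - 1\<close> of
  \<open>control_term\<close>.\<close>

lemma sums_boundary_flux:
  assumes "0 < t"
  shows "(\<lambda>i. Y (Suc i) t / fact (2 * Suc i - 1)) sums boundary_flux 0 t"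
proof -
  let ?f = "\<lambda>n. even_coeff Y (n + 1) t / fact n * 1 ^ n"
  have "?f sums flat_series Y 1 t 1"
    unfolding flat_series_def using summable_flat_series[OF assms] by (rule summable_sums)
  moreover have "strict_mono (\<lambda>i::nat. 2 * i + 1)" by (simp add: strict_mono_def)
  moreover have "?f n = 0" if "n \<notin> range (\<lambda>i. 2 * i + 1)" for n
  proof -
    have "even n"
    proof (rule ccontr)
      assume "odd n"
      then obtain i where "n = 2 * i + 1" by (rule oddE)
      with that show False by blast
    qed
    then show ?thesis by (simp add: even_coeff_def)
  qed
  ultimately have "(\<lambda>i. ?f (2 * i + 1)) sums flat_series Y 1 t 1"
    using sums_mono_reindex[of "\<lambda>i. 2 * i + 1" ?f] by blast
  then show ?thesis by (simp add: even_coeff_def boundary_flux_def)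
qed

end

section \<open>The uncontrolled solution as a flat series\<close>

lemma infsum_nat_eq_suminf:
  fixes f :: "nat \<Rightarrow> real"
  assumes "f summable_on UNIV"
  shows "infsum f UNIV = suminf f"
  using has_sum_imp_sums[OF has_sum_infsum[OF assms]] by (rule sums_unique)

text \<open>The nonnegative \<open>h\<close> is summable first in j, then in n. Hence f is
  absolutely summable over pairs, and for unordered sums the order of summation is free.\<close>

lemma suminf_swap_majorant:
  fixes f h :: "nat \<Rightarrow> nat \<Rightarrow> real"
  assumes "\<And>n j. \<bar>f n j\<bar> \<le> h n j" "\<And>n. h n sums g n" "summable g"
  shows "(\<Sum>j. \<Sum>n. f n j) = (\<Sum>n. \<Sum>j. f n j)"
proof -
  have h0: "0 \<le> h n j" for n j using assms(1)[of n j] by linarith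
  have g0: "0 \<le> g n" for n using sums_le[OF h0 sums_zero assms(2)] .
  have "(\<lambda>(n, j). h n j) summable_on UNIV \<times> UNIV"
    by (rule summable_on_SigmaI[where g = g])
       (use assms(3) h0 g0 sums_nonneg_imp_has_sum[OF assms(2) h0]
        in \<open>auto intro: summable_nonneg_imp_summable_on\<close>)
  then have "(\<lambda>p. norm (case p of (n, j) \<Rightarrow> f n j)) summable_on UNIV \<times> UNIV"
    by (rule Infinite_Sum.abs_summable_on_comparison_test') (simp add: assms(1) case_prod_unfold)
  then have f: "(\<lambda>(n, j). f n j) summable_on UNIV \<times> UNIV"
    by (rule Infinite_Sum.abs_summable_summable)
  then have f': "(\<lambda>(j, n). f n j) summable_on UNIV \<times> UNIV"
    by (subst (asm) summable_on_swap) (simp add: case_prod_unfold)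
  have 1: "f n summable_on UNIV" "(\<lambda>n. f n j) summable_on UNIV" for n j
    using summable_on_SigmaD1[OF f] summable_on_SigmaD1[OF f'] by auto
  have "(\<lambda>n. infsum (f n) UNIV) summable_on UNIV" "(\<lambda>j. infsum (\<lambda>n. f n j) UNIV) summable_on UNIV"
    using summable_on_SigmaD[OF f] summable_on_SigmaD[OF f'] 1 by auto
  then show ?thesis
    using infsum_swap_banach[OF f] 1 by (simp add: infsum_nat_eq_suminf)
qed

section \<open>Neumann eigenvalues and the trace at x = 0\<close>

definition eigval :: "nat \<Rightarrow> real" where
  "eigval n = (real n * pi)\<^sup>2"

lemma eigval_nonneg [simp]: "0 \<le> eigval n"
  by (simp add: eigval_def)

lemma neg_eigval_power: "(- eigval n) ^ k = (real n * pi) ^ (2 * k) * (- 1) ^ k"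
  unfolding eigval_def power_mult by (subst power_minus) (rule mult.commute)

lemma real_le_eigval: "real n \<le> eigval n"
proof (cases n)
  case (Suc m)
  have "1 \<le> real n * pi" "1 \<le> pi"
    using Suc pi_gt3 by (auto intro!: mult_ge1_I)
  then have "real n * 1 \<le> real n * pi" "(real n * pi) * 1 \<le> (real n * pi) * (real n * pi)"
    by (intro mult_left_mono; simp)+
  then show ?thesis unfolding eigval_def power2_eq_square by linarith
qed (simp add: eigval_def)

text \<open>\<open>eigval n\<close> is at least n, so a geometric series with ratio
  \<open>exp (- \<epsilon>)\<close> dominates.\<close>

lemma summable_exp_eigval:
  assumes "0 < \<epsilon>"
  shows "summable (\<lambda>n. exp (- eigval n * \<epsilon>))"
proof (rule summable_comparison_test'[of "\<lambda>n. exp (- \<epsilon>) ^ n" 0])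
  show "summable (\<lambda>n. exp (- \<epsilon>) ^ n)" using assms by (intro summable_geometric) auto
  show "norm (exp (- eigval n * \<epsilon>)) \<le> exp (- \<epsilon>) ^ n" for n
    using assms mult_right_mono[OF real_le_eigval[of n], of \<epsilon>] by (simp flip: exp_of_nat_mult)
qed

text \<open>\<open>heat_trace c k\<close> is the \<open>k\<close>-th time derivative at \<open>x = 0\<close> of the free solution
  \<open>\<Sum> c n * exp (- (n\<pi>)\<^sup>2 t) * cos (n\<pi>x)\<close>.\<close>

definition heat_trace :: "(nat \<Rightarrow> real) \<Rightarrow> nat \<Rightarrow> real \<Rightarrow> real" where
  "heat_trace c k t = (\<Sum>n. c n * (- eigval n) ^ k * exp (- eigval n * t))"

text \<open>For \<open>t > 0\<close> the factors \<open>exp (- eigval n * t)\<close> make bounded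
  coefficients as good as square summable ones; for square integrable data the bound comes from the
  Cauchy-Schwarz inequality.\<close>

locale bounded_coeffs =
  fixes c :: "nat \<Rightarrow> real" and C :: real
  assumes c: "\<And>n. \<bar>c n\<bar> \<le> C"
begin

lemma C_nonneg: "0 \<le> C"
  using c[of 0] by linarith

text \<open>Half of the decay \<open>exp (- eigval n * \<epsilon>)\<close> absorbs
  \<open>eigval n ^ k\<close> at the price \<open>fact k * (2 / \<epsilon>) ^ k\<close>, which is
  Gevrey order 1; the other half is left for summing over n.\<close>

lemma heat_trace_term_bound:
  assumes "0 < \<epsilon>" "\<epsilon> \<le> t"
  shows "\<bar>c n * (- eigval n) ^ k * exp (- eigval n * t)\<bar>
    \<le> fact k * (2 / \<epsilon>) ^ k * (C * exp (- eigval n * (\<epsilon> / 2)))"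
proof -
  have "eigval n ^ k = (2 / \<epsilon>) ^ k * (eigval n * (\<epsilon> / 2)) ^ k"
    using assms by (simp flip: power_mult_distrib)
  also have "\<dots> \<le> (2 / \<epsilon>) ^ k * (fact k * exp (eigval n * (\<epsilon> / 2)))"
    using assms by (intro mult_left_mono power_le_fact_exp) auto
  finally have "eigval n ^ k * exp (- eigval n * \<epsilon>)
      \<le> (2 / \<epsilon>) ^ k * (fact k * exp (eigval n * (\<epsilon> / 2))) * exp (- eigval n * \<epsilon>)"
    by (intro mult_right_mono) auto
  also have "\<dots> = fact k * (2 / \<epsilon>) ^ k * (exp (eigval n * (\<epsilon> / 2)) * exp (- eigval n * \<epsilon>))"
    by (simp only: mult_ac)
  also have "exp (eigval n * (\<epsilon> / 2)) * exp (- eigval n * \<epsilon>) = exp (- eigval n * (\<epsilon> / 2))"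
    by (simp add: field_simps flip: exp_add)
  finally have 1: "eigval n ^ k * exp (- eigval n * \<epsilon>) \<le> fact k * (2 / \<epsilon>) ^ k * exp (- eigval n * (\<epsilon> / 2))" .
  have "\<bar>c n * (- eigval n) ^ k * exp (- eigval n * t)\<bar> = \<bar>c n\<bar> * (eigval n ^ k * exp (- eigval n * t))"
    by (simp add: abs_mult power_abs)
  also have "\<dots> \<le> C * (eigval n ^ k * exp (- eigval n * \<epsilon>))"
    using assms C_nonneg by (intro mult_mono c) (auto intro!: mult_left_mono)
  also have "\<dots> \<le> C * (fact k * (2 / \<epsilon>) ^ k * exp (- eigval n * (\<epsilon> / 2)))"
    using C_nonneg by (intro mult_left_mono 1) auto
  finally show ?thesis by (simp add: mult_ac)
qed

lemma summable_heat_trace_majorant: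
  "0 < \<epsilon> \<Longrightarrow> summable (\<lambda>n. B * (C * exp (- eigval n * (\<epsilon> / 2))))"
  by (intro summable_mult summable_exp_eigval) auto

lemma summable_heat_trace:
  "0 < t \<Longrightarrow> summable (\<lambda>n. c n * (- eigval n) ^ k * exp (- eigval n * t))"
  by (rule summable_comparison_test'[OF summable_heat_trace_majorant, of t 0])
     (use heat_trace_term_bound[of t t] in auto)

lemma deriv_seq_heat_trace: "deriv_seq {0<..} (heat_trace c)"
  unfolding deriv_seq_def
proof (intro allI ballI)
  fix k and t :: real assume "t \<in> {0<..}"
  then have t: "0 < t" by simp
  have "((\<lambda>t. \<Sum>n. c n * (- eigval n) ^ k * exp (- eigval n * t)) has_real_derivative
     (\<Sum>n. c n * (- eigval n) ^ Suc k * exp (- eigval n * t))) (at t)"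
  proof (rule has_field_derivative_series'(2))
    show "convex {t/2..}" by simp
    show "uniformly_convergent_on {t/2..} (\<lambda>n t. \<Sum>i<n. c i * (- eigval i) ^ Suc k * exp (- eigval i * t))"
    proof (rule Weierstrass_m_test')
      show "norm (c n * (- eigval n) ^ Suc k * exp (- eigval n * r))
          \<le> fact (Suc k) * (2 / (t / 2)) ^ Suc k * (C * exp (- eigval n * ((t / 2) / 2)))"
        if "r \<in> {t/2..}" for n r
        using heat_trace_term_bound[of "t / 2" r n "Suc k"] that t by (simp only: real_norm_def) simp
    qed (use t in \<open>intro summable_heat_trace_majorant, simp\<close>)
    show "t \<in> {t/2..}" "t \<in> interior {t/2..}" using t by auto
    show "summable (\<lambda>n. c n * (- eigval n) ^ k * exp (- eigval n * t))"
      by (rule summable_heat_trace[OF t])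
    show "((\<lambda>t. c n * (- eigval n) ^ k * exp (- eigval n * t)) has_real_derivative
        c n * (- eigval n) ^ Suc k * exp (- eigval n * r)) (at r within {t/2..})" for n r
      by (auto intro!: derivative_eq_intros)
  qed
  then show "(heat_trace c k has_real_derivative heat_trace c (Suc k) t) (at t)"
    by (simp only: heat_trace_def[abs_def])
qed

lemma gevrey_bound_heat_trace:
  assumes "0 < \<epsilon>"
  shows "gevrey_bound 1 {\<epsilon>..} (heat_trace c)"
proof -
  define M where "M = (\<Sum>n. C * exp (- eigval n * (\<epsilon> / 2)))"
  have sM: "summable (\<lambda>n. C * exp (- eigval n * (\<epsilon> / 2)))"
    using summable_heat_trace_majorant[OF assms, of 1] by simp
  have "M \<ge> 0" unfolding M_def using C_nonneg by (intro suminf_nonneg sM) auto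
  have "\<bar>heat_trace c k t\<bar> \<le> (1 + M) * fact k powr 1 * (2 / \<epsilon>) ^ k" if "\<epsilon> \<le> t" for k t
  proof -
    have "\<bar>heat_trace c k t\<bar> \<le> (\<Sum>n. fact k * (2 / \<epsilon>) ^ k * (C * exp (- eigval n * (\<epsilon> / 2))))"
      unfolding heat_trace_def real_norm_def[symmetric]
      by (rule norm_suminf_le)
         (use heat_trace_term_bound[OF assms that] summable_heat_trace_majorant[OF assms] in auto)
    also have "\<dots> = fact k * (2 / \<epsilon>) ^ k * M"
      unfolding M_def using sM by (rule suminf_mult)
    also have "\<dots> \<le> fact k * (2 / \<epsilon>) ^ k * (1 + M)"
      using assms by (intro mult_left_mono) auto
    finally show ?thesis by (simp add: mult_ac)
  qed
  then show ?thesis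
    using assms \<open>M \<ge> 0\<close> unfolding gevrey_bound_def
    by (intro exI[of _ "1 + M"] exI[of _ "2 / \<epsilon>"] conjI) auto
qed

end

text \<open>\<open>cos_sign m\<close> is the m-th derivative of the cosine at 0, and
  \<open>cos_deriv_series q\<close> the power series of its q-th derivative. The zeros at odd m
  match those of \<open>even_coeff\<close>.\<close>

definition cos_sign :: "nat \<Rightarrow> real" where
  "cos_sign m = (if even m then (- 1) ^ (m div 2) else 0)"

definition cos_deriv_series :: "nat \<Rightarrow> real \<Rightarrow> real" where
  "cos_deriv_series q z = (\<Sum>j. cos_sign (j + q) / fact j * z ^ j)"

lemma cos_deriv_series_0: "cos_deriv_series 0 z = cos z"
proof -
  have "cos_sign j / fact j * z ^ j = cos_coeff j *\<^sub>R z ^ j" for j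
    by (simp add: cos_sign_def cos_coeff_def)
  then show ?thesis
    using cos_converges[of z] by (simp add: cos_deriv_series_def sums_iff)
qed

lemma cos_deriv_series_1: "cos_deriv_series 1 z = - sin z"
proof -
  have "cos_sign (j + 1) / fact j * z ^ j = - (sin_coeff j *\<^sub>R z ^ j)" for j
    by (auto simp: cos_sign_def sin_coeff_def elim!: oddE)
  then show ?thesis
    using sums_minus[OF sin_converges[of z]] by (simp add: cos_deriv_series_def sums_iff)
qed

text \<open>Odd derivatives of the cosine are, up to sign, the sine. At multiples of
  \<open>pi\<close> this makes every odd x-derivative of the free solution vanish at x = 1.\<close>

lemma cos_deriv_series_odd_zero:
  assumes "sin z = 0"
  shows "cos_deriv_series (Suc (2 * k)) z = 0"
proof -
  have "cos_sign (j + Suc (2 * k)) = (- 1) ^ k * cos_sign (j + 1)" for j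
    by (auto simp: cos_sign_def power_add elim!: oddE)
  then have "cos_deriv_series (Suc (2 * k)) z = (\<Sum>j. (- 1) ^ k * (cos_sign (j + 1) / fact j * z ^ j))"
    by (simp only: cos_deriv_series_def mult.assoc times_divide_eq_left times_divide_eq_right)
  also have "\<dots> = (- 1) ^ k * cos_deriv_series 1 z"
  proof -
    have "(\<lambda>j. - (sin_coeff j *\<^sub>R z ^ j)) = (\<lambda>j. cos_sign (j + 1) / fact j * z ^ j)"
      by (auto simp: fun_eq_iff cos_sign_def sin_coeff_def elim!: oddE)
    then have "summable (\<lambda>j. cos_sign (j + 1) / fact j * z ^ j)"
      using sums_summable[OF sums_minus[OF sin_converges[of z]]] by simp
    then show ?thesis unfolding cos_deriv_series_def by (rule suminf_mult)
  qed
  finally show ?thesis using assms by (simp only: cos_deriv_series_1)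
qed

text \<open>With \<open>y = real n * pi\<close>, completing the square bounds
  \<open>y * (X + 2) - y\<^sup>2 * t\<close> by \<open>(X + 2)\<^sup>2 / (4 * t)\<close>. Of the
  extra \<open>2 * y\<close>, one y pays for \<open>y ^ q\<close> through
  \<open>power_le_fact_exp\<close>; the other, being at least n, leaves the geometric factor
  \<open>exp (- 1) ^ n\<close>.\<close>

lemma exp_eigval_growth_bound:
  assumes "0 < t"
  shows "(real n * pi) ^ q * exp (real n * pi * X) * exp (- eigval n * t)
    \<le> fact q * exp ((X + 2)\<^sup>2 / (4 * t)) * exp (- 1) ^ n"
proof -
  define y where "y = real n * pi"
  have y: "0 \<le> y" by (simp add: y_def)
  have n: "real n \<le> y" using pi_gt3 mult_left_mono[of 1 pi "real n"] by (simp add: y_def)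
  have "0 \<le> t * (y - (X + 2) / (2 * t))\<^sup>2" using assms by simp
  also have "\<dots> = y\<^sup>2 * t - y * (X + 2) + (X + 2)\<^sup>2 / (4 * t)"
    using assms by (simp add: power2_eq_square field_simps)
  finally have "y + y * X - y\<^sup>2 * t \<le> (X + 2)\<^sup>2 / (4 * t) - real n"
    using n by (simp add: algebra_simps)
  then have 1: "exp (y + y * X - y\<^sup>2 * t) \<le> exp ((X + 2)\<^sup>2 / (4 * t) - real n)" by simp
  have "y ^ q * exp (y * X) * exp (- (y\<^sup>2 * t)) \<le> (fact q * exp y) * exp (y * X) * exp (- (y\<^sup>2 * t))"
    using y by (intro mult_right_mono power_le_fact_exp) auto
  also have "\<dots> = fact q * exp (y + y * X - y\<^sup>2 * t)"
    by (simp add: exp_add exp_diff exp_minus field_simps)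
  also have "\<dots> \<le> fact q * exp ((X + 2)\<^sup>2 / (4 * t) - real n)"
    using 1 by (intro mult_left_mono) auto
  also have "\<dots> = fact q * exp ((X + 2)\<^sup>2 / (4 * t)) * exp (- 1) ^ n"
    by (simp add: exp_diff exp_minus field_simps flip: exp_of_nat_mult)
  finally show ?thesis by (simp add: y_def eigval_def)
qed

context bounded_coeffs
begin

lemma even_coeff_heat_trace:
  assumes "0 < t"
  shows "even_coeff (heat_trace c) m t = (\<Sum>n. c n * exp (- eigval n * t) * ((real n * pi) ^ m * cos_sign m))"
proof (cases "even m")
  case True
  then obtain k where "m = 2 * k" by auto
  then show ?thesis
    by (simp add: even_coeff_def heat_trace_def cos_sign_def neg_eigval_power mult_ac)
qed (simp add: even_coeff_def cos_sign_def)

text \<open>After the exchange of sums the inner sum, over the powers of x, is the series of a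
  derivative of the cosine: the trace at x = 0 alone reproduces the free solution and its
  derivatives at every x.\<close>

lemma flat_series_heat_trace:
  assumes "0 < t"
  shows "flat_series (heat_trace c) q t x =
    (\<Sum>n. c n * exp (- eigval n * t) * ((real n * pi) ^ q * cos_deriv_series q (real n * pi * x)))"
proof -
  define f where "f n j = c n * exp (- eigval n * t) * ((real n * pi) ^ (j + q) * cos_sign (j + q) / fact j * x ^ j)"
    for n j
  define K where "K n = \<bar>c n\<bar> * exp (- eigval n * t) * (real n * pi) ^ q" for n
  have *: "even_coeff (heat_trace c) (j + q) t / fact j * x ^ j = (\<Sum>n. f n j)" for j
  proof -
    have s: "summable (\<lambda>n. c n * exp (- eigval n * t) * ((real n * pi) ^ (j + q) * cos_sign (j + q)))"
    proof (cases "even (j + q)")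
      case True
      then obtain k where k: "j + q = 2 * k" by (rule evenE)
      then show ?thesis
        using summable_heat_trace[OF assms, of k] by (simp add: k cos_sign_def neg_eigval_power mult_ac)
    qed (simp add: cos_sign_def)
    have "even_coeff (heat_trace c) (j + q) t / fact j * x ^ j = even_coeff (heat_trace c) (j + q) t * (x ^ j / fact j)"
      by simp
    also have "\<dots> = (\<Sum>n. f n j)"
      unfolding even_coeff_heat_trace[OF assms] f_def suminf_mult2[OF s]
      by (simp add: mult_ac)
    finally show ?thesis .
  qed
  have "flat_series (heat_trace c) q t x = (\<Sum>j. \<Sum>n. f n j)"
    by (simp only: flat_series_def *)
  also have "\<dots> = (\<Sum>n. \<Sum>j. f n j)"
  proof (rule suminf_swap_majorant)
    show "\<bar>f n j\<bar> \<le> K n * ((real n * pi * \<bar>x\<bar>) ^ j /\<^sub>R fact j)" for n j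
    proof -
      have "\<bar>f n j\<bar> = K n * ((real n * pi * \<bar>x\<bar>) ^ j /\<^sub>R fact j) * \<bar>cos_sign (j + q)\<bar>"
        by (simp add: f_def K_def abs_mult power_abs power_add power_mult_distrib divide_inverse)
      also have "\<dots> \<le> K n * ((real n * pi * \<bar>x\<bar>) ^ j /\<^sub>R fact j) * 1"
        by (intro mult_left_mono) (auto simp: cos_sign_def K_def)
      finally show ?thesis by simp
    qed
    show "(\<lambda>j. K n * ((real n * pi * \<bar>x\<bar>) ^ j /\<^sub>R fact j)) sums (K n * exp (real n * pi * \<bar>x\<bar>))" for n
      by (intro sums_mult exp_converges)
    show "summable (\<lambda>n. K n * exp (real n * pi * \<bar>x\<bar>))"
    proof (rule summable_comparison_test'[where N = 0])
      show "summable (\<lambda>n. C * (fact q * exp ((\<bar>x\<bar> + 2)\<^sup>2 / (4 * t))) * exp (- 1) ^ n)"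
        by (intro summable_mult summable_geometric) auto
      fix n
      have "norm (K n * exp (real n * pi * \<bar>x\<bar>))
          = \<bar>c n\<bar> * ((real n * pi) ^ q * exp (real n * pi * \<bar>x\<bar>) * exp (- eigval n * t))"
        by (simp add: K_def abs_mult)
      also have "\<dots> \<le> C * (fact q * exp ((\<bar>x\<bar> + 2)\<^sup>2 / (4 * t)) * exp (- 1) ^ n)"
        using C_nonneg by (intro mult_mono c exp_eigval_growth_bound[OF assms]) auto
      finally show "norm (K n * exp (real n * pi * \<bar>x\<bar>))
          \<le> C * (fact q * exp ((\<bar>x\<bar> + 2)\<^sup>2 / (4 * t))) * exp (- 1) ^ n"
        by (simp add: mult.assoc)
    qed
  qed
  finally have "flat_series (heat_trace c) q t x = (\<Sum>n. \<Sum>j. f n j)" .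
  moreover have "(\<Sum>j. f n j) = c n * exp (- eigval n * t) * ((real n * pi) ^ q * cos_deriv_series q (real n * pi * x))" for n
  proof -
    define z where "z = real n * pi * x"
    have "summable (\<lambda>j. cos_sign (j + q) / fact j * z ^ j)"
    proof (rule summable_comparison_test'[where N = 0])
      show "summable (\<lambda>j. \<bar>z\<bar> ^ j /\<^sub>R fact j)" by (rule summable_exp_generic)
      show "norm (cos_sign (j + q) / fact j * z ^ j) \<le> \<bar>z\<bar> ^ j /\<^sub>R fact j" for j
        by (auto simp: cos_sign_def abs_mult power_abs divide_inverse)
    qed
    then have "(\<Sum>j. c n * exp (- eigval n * t) * (real n * pi) ^ q * (cos_sign (j + q) / fact j * z ^ j))
       = c n * exp (- eigval n * t) * (real n * pi) ^ q * cos_deriv_series q z"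
      unfolding cos_deriv_series_def by (rule suminf_mult)
    then show ?thesis
      by (simp add: f_def z_def power_add power_mult_distrib mult_ac)
  qed
  ultimately show ?thesis by simp
qed

lemma flat_series_heat_trace_0:
  assumes "0 < t"
  shows "flat_series (heat_trace c) 0 t x = (\<Sum>n. c n * exp (- eigval n * t) * cos (real n * pi * x))"
  using flat_series_heat_trace[OF assms, of 0 x] by (simp add: cos_deriv_series_0)

lemma flat_series_heat_trace_boundary:
  assumes "0 < t"
  shows "flat_series (heat_trace c) (Suc (2 * k)) t 1 = 0"
  using flat_series_heat_trace[OF assms, of "Suc (2 * k)" 1]
  by (simp only: cos_deriv_series_odd_zero sin_npi mult_1_right) simp

end

section \<open>Cosine expansions in \<open>L\<^sup>2(0,1)\<close>\<close>

lemma space_unit_measure [simp]: "space unit_measure = {0<..<1}"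
  by (simp add: space_restrict_space)

lemma finite_measure_unit: "finite_measure unit_measure"
  by (rule finite_measureI) (simp add: emeasure_restrict_space)

lemma continuous_imp_measurable_unit:
  assumes "continuous_on {0..1} (g :: real \<Rightarrow> real)"
  shows "g \<in> borel_measurable unit_measure"
  by (rule continuous_imp_measurable_on_sets_lebesgue[OF continuous_on_subset[OF assms]]) auto

lemma integrable_unit_bounded:
  fixes g :: "real \<Rightarrow> real"
  assumes "g \<in> borel_measurable unit_measure" "\<And>x. 0 < x \<Longrightarrow> x < 1 \<Longrightarrow> \<bar>g x\<bar> \<le> B"
  shows "integrable unit_measure g"
  by (rule finite_measure.integrable_const_bound[OF finite_measure_unit, of _ B])
     (use assms in \<open>auto intro!: AE_I2\<close>)

lemma continuous_bounded_unit:
  fixes g :: "real \<Rightarrow> real"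
  assumes "continuous_on {0..1} g"
  obtains B where "\<And>x. 0 \<le> x \<Longrightarrow> x \<le> 1 \<Longrightarrow> \<bar>g x\<bar> \<le> B"
proof -
  have "bounded (g ` {0..1})"
    using assms by (intro compact_imp_bounded compact_continuous_image) auto
  then have "\<exists>B. \<forall>x\<in>{0..1}. \<bar>g x\<bar> \<le> B" by (auto simp: bounded_iff)
  then obtain B where "\<forall>x\<in>{0..1}. \<bar>g x\<bar> \<le> B" ..
  then show ?thesis by (intro that[of B]) simp
qed

lemma integrable_unit_continuous:
  fixes g :: "real \<Rightarrow> real"
  assumes "continuous_on {0..1} g"
  shows "integrable unit_measure g"
proof -
  obtain B where "\<And>x. 0 \<le> x \<Longrightarrow> x \<le> 1 \<Longrightarrow> \<bar>g x\<bar> \<le> B"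
    using continuous_bounded_unit[OF assms] by metis
  then show ?thesis
    by (intro integrable_unit_bounded[of g B] continuous_imp_measurable_unit assms) auto
qed

lemma integral_unit_eq:
  fixes g :: "real \<Rightarrow> real"
  assumes "continuous_on {0..1} g"
  shows "(LINT x|unit_measure. g x) = integral {0..1} g"
proof -
  have "(LINT x|unit_measure. g x) = integral {0<..<1} g"
    by (intro lebesgue_integral_eq_integral integrable_unit_continuous assms) auto
  also have "\<dots> = integral {0..1} g"
    by (simp add: integral_open_interval_real)
  finally show ?thesis .
qed

lemma L2_unitD: "f \<in> L2_unit \<Longrightarrow> f \<in> borel_measurable unit_measure"
  "f \<in> L2_unit \<Longrightarrow> integrable unit_measure (\<lambda>x. (f x)\<^sup>2)"
  by (auto simp: L2_unit_def)

lemma L2_unit_continuous: "continuous_on {0..1} g \<Longrightarrow> g \<in> L2_unit"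
  unfolding L2_unit_def
  by (auto intro!: continuous_imp_measurable_unit integrable_unit_continuous continuous_intros)

lemma L2_unit_mult_integrable:
  assumes "f \<in> L2_unit" "g \<in> L2_unit"
  shows "integrable unit_measure (\<lambda>x. f x * g x)"
proof (rule Bochner_Integration.integrable_bound)
  show "integrable unit_measure (\<lambda>x. (f x)\<^sup>2 + (g x)\<^sup>2)"
    using assms by (intro Bochner_Integration.integrable_add L2_unitD)
  show "(\<lambda>x. f x * g x) \<in> borel_measurable unit_measure"
    using assms by (intro borel_measurable_times L2_unitD)
  have "\<bar>f x * g x\<bar> \<le> (f x)\<^sup>2 + (g x)\<^sup>2" for x
  proof -
    have "2 * \<bar>f x\<bar> * \<bar>g x\<bar> \<le> (f x)\<^sup>2 + (g x)\<^sup>2"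
      using sum_squares_bound[of "\<bar>f x\<bar>" "\<bar>g x\<bar>"] by simp
    moreover have "0 \<le> \<bar>f x\<bar> * \<bar>g x\<bar>" by simp
    ultimately show ?thesis unfolding abs_mult by linarith
  qed
  then show "AE x in unit_measure. norm (f x * g x) \<le> norm ((f x)\<^sup>2 + (g x)\<^sup>2)"
    by (intro AE_I2) simp
qed

lemma L2_unit_add:
  assumes "f \<in> L2_unit" "g \<in> L2_unit"
  shows "(\<lambda>x. f x + g x) \<in> L2_unit"
  using L2_unitD[OF assms(1)] L2_unitD[OF assms(2)] L2_unit_mult_integrable[OF assms]
  by (auto simp: L2_unit_def power2_sum mult.assoc)

lemma L2_unit_scale:
  assumes "f \<in> L2_unit"
  shows "(\<lambda>x. c * f x) \<in> L2_unit"
  using L2_unitD[OF assms] by (auto simp: L2_unit_def power_mult_distrib)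

lemma L2_unit_diff:
  assumes "f \<in> L2_unit" "g \<in> L2_unit"
  shows "(\<lambda>x. f x - g x) \<in> L2_unit"
  using L2_unit_add[OF assms(1) L2_unit_scale[OF assms(2), of "-1"]] by simp

lemma L2_unit_sum: "(\<And>i. i \<in> I \<Longrightarrow> f i \<in> L2_unit) \<Longrightarrow> (\<lambda>x. \<Sum>i\<in>I. f i x) \<in> L2_unit"
  by (induction I rule: infinite_finite_induct)
     (auto intro: L2_unit_add intro!: L2_unit_continuous[of "\<lambda>_. 0"])

definition inner_unit :: "(real \<Rightarrow> real) \<Rightarrow> (real \<Rightarrow> real) \<Rightarrow> real" where
  "inner_unit f g = (LINT x|unit_measure. f x * g x)"

lemma inner_unit_commute: "inner_unit f g = inner_unit g f"
  by (simp add: inner_unit_def mult.commute)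

lemma inner_unit_diff_left:
  "f \<in> L2_unit \<Longrightarrow> g \<in> L2_unit \<Longrightarrow> h \<in> L2_unit \<Longrightarrow>
   inner_unit (\<lambda>x. f x - g x) h = inner_unit f h - inner_unit g h"
  by (simp add: inner_unit_def left_diff_distrib L2_unit_mult_integrable)

lemma inner_unit_diff_right:
  "f \<in> L2_unit \<Longrightarrow> g \<in> L2_unit \<Longrightarrow> h \<in> L2_unit \<Longrightarrow>
   inner_unit h (\<lambda>x. f x - g x) = inner_unit h f - inner_unit h g"
  using inner_unit_diff_left[of f g h] by (simp add: inner_unit_commute)

lemma inner_unit_scale_left: "inner_unit (\<lambda>x. c * f x) h = c * inner_unit f h"
  by (simp add: inner_unit_def mult.assoc)

lemma inner_unit_sum_left:
  "(\<And>i. i \<in> I \<Longrightarrow> f i \<in> L2_unit) \<Longrightarrow> h \<in> L2_unit \<Longrightarrow>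
   inner_unit (\<lambda>x. \<Sum>i\<in>I. f i x) h = (\<Sum>i\<in>I. inner_unit (f i) h)"
  by (simp add: inner_unit_def sum_distrib_right L2_unit_mult_integrable)

lemma inner_unit_nonneg: "0 \<le> inner_unit f f"
  unfolding inner_unit_def by (rule integral_nonneg_AE) auto

lemma L2_norm_unit_eq: "L2_norm_unit f = sqrt (inner_unit f f)"
  by (simp add: L2_norm_unit_def inner_unit_def power2_eq_square)

lemma inner_unit_self_diff:
  assumes "f \<in> L2_unit" "g \<in> L2_unit"
  shows "inner_unit (\<lambda>x. f x - g x) (\<lambda>x. f x - g x) = inner_unit f f - 2 * inner_unit f g + inner_unit g g"
  using assms
  by (simp add: inner_unit_diff_left inner_unit_diff_right L2_unit_diff inner_unit_commute[of g f])

text \<open>The triangle inequality in the form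
  \<open>(a + b)\<^sup>2 \<le> 2 * a\<^sup>2 + 2 * b\<^sup>2\<close>, which keeps square roots out
  of the approximation arguments.\<close>

lemma inner_unit_self_diff_triangle:
  assumes "f \<in> L2_unit" "g \<in> L2_unit" "h \<in> L2_unit"
  shows "inner_unit (\<lambda>x. f x - h x) (\<lambda>x. f x - h x)
    \<le> 2 * inner_unit (\<lambda>x. f x - g x) (\<lambda>x. f x - g x) + 2 * inner_unit (\<lambda>x. g x - h x) (\<lambda>x. g x - h x)"
proof -
  note D = L2_unit_diff[OF assms(1,3)] L2_unit_diff[OF assms(1,2)] L2_unit_diff[OF assms(2,3)]
  have "(f x - h x) * (f x - h x) \<le> 2 * ((f x - g x) * (f x - g x)) + 2 * ((g x - h x) * (g x - h x))" for x
    using sum_squares_bound[of "f x - g x" "g x - h x"] by (simp add: power2_eq_square algebra_simps)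
  then have "inner_unit (\<lambda>x. f x - h x) (\<lambda>x. f x - h x)
     \<le> (LINT x|unit_measure. 2 * ((f x - g x) * (f x - g x)) + 2 * ((g x - h x) * (g x - h x)))"
    unfolding inner_unit_def
    by (intro integral_mono L2_unit_mult_integrable D Bochner_Integration.integrable_add integrable_mult_right) auto
  also have "\<dots> = 2 * inner_unit (\<lambda>x. f x - g x) (\<lambda>x. f x - g x) + 2 * inner_unit (\<lambda>x. g x - h x) (\<lambda>x. g x - h x)"
    by (simp add: inner_unit_def L2_unit_mult_integrable D)
  finally show ?thesis .
qed

lemma inner_unit_self_zero:
  assumes "f \<in> L2_unit" "inner_unit f f = 0"
  shows "AE x in unit_measure. f x = 0"
proof -
  have "AE x in unit_measure. f x * f x = 0"
    using assms L2_unit_mult_integrable[OF assms(1,1)]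
    by (subst (asm) inner_unit_def, subst (asm) integral_nonneg_eq_0_iff_AE) auto
  then show ?thesis by simp
qed

lemma inner_unit_Cauchy_Schwarz:
  assumes f: "f \<in> L2_unit" and g: "g \<in> L2_unit"
  shows "\<bar>inner_unit f g\<bar> \<le> sqrt (inner_unit f f) * sqrt (inner_unit g g)"
proof -
  have *: "0 \<le> inner_unit f f - 2 * r * inner_unit f g + r\<^sup>2 * inner_unit g g" for r
  proof -
    have "inner_unit (\<lambda>x. f x - r * g x) (\<lambda>x. f x - r * g x)
       = inner_unit f f - 2 * r * inner_unit f g + r\<^sup>2 * inner_unit g g"
      using f g by (simp add: inner_unit_self_diff L2_unit_scale inner_unit_scale_left
        inner_unit_commute[of f "\<lambda>x. r * g x"] inner_unit_commute[of g "\<lambda>x. r * g x"]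
        inner_unit_commute[of g f] power2_eq_square)
    then show ?thesis using inner_unit_nonneg by metis
  qed
  have "(inner_unit f g)\<^sup>2 \<le> inner_unit f f * inner_unit g g"
  proof (cases "inner_unit g g = 0")
    case True
    have "inner_unit f g = 0"
    proof (rule ccontr)
      assume "inner_unit f g \<noteq> 0"
      \<comment> \<open>Here the quadratic in r is affine, and this r gives it the value -1.\<close>
      with *[of "(inner_unit f f + 1) / (2 * inner_unit f g)"] True show False
        by (simp add: field_simps)
    qed
    with True show ?thesis by simp
  next
    case False
    then have pos: "0 < inner_unit g g" using inner_unit_nonneg[of g] by simp
    \<comment> \<open>This r minimises the quadratic.\<close>
    from *[of "inner_unit f g / inner_unit g g"] pos
    have "0 \<le> inner_unit f f - (inner_unit f g)\<^sup>2 / inner_unit g g"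
      by (simp add: power2_eq_square field_simps)
    with pos show ?thesis by (simp add: field_simps)
  qed
  then have "sqrt ((inner_unit f g)\<^sup>2) \<le> sqrt (inner_unit f f * inner_unit g g)"
    by (rule real_sqrt_le_mono)
  then show ?thesis by (simp add: real_sqrt_mult)
qed

section \<open>Density of the continuous functions in L2\<close>

lemma L2_unit_bounded_approx:
  assumes f: "f \<in> L2_unit" and M: "\<And>x. \<bar>f x\<bar> \<le> M" and e: "0 < e"
  obtains g where "continuous_on UNIV g" "inner_unit (\<lambda>x. f x - g x) (\<lambda>x. f x - g x) < e"
proof -
  define F where "F x = (if x \<in> {0<..<1} then f x else 0)" for x
  have "F \<in> borel_measurable lebesgue"
    unfolding F_def using L2_unitD(1)[OF f] by (subst borel_measurable_if) auto
  then have "F measurable_on {0<..<1}"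
    by (rule lebesgue_measurable_imp_measurable_on_real) auto
  then obtain N g where N: "negligible N" and g: "\<And>n. continuous_on UNIV (g n)"
    and lim: "\<And>x. x \<notin> N \<Longrightarrow> (\<lambda>n. g n x) \<longlonglongrightarrow> (if x \<in> {0<..<1} then F x else 0)"
    unfolding measurable_on_def by blast
  \<comment> \<open>Clamping the almost everywhere convergent continuous functions to [-M, M], where
    f takes its values, keeps the limit and supplies the bound for dominated convergence.\<close>
  define h where "h n x = max (- M) (min M (g n x))" for n :: nat and x
  have M0: "0 \<le> M" using M[of 0] by linarith
  have h: "continuous_on A (h n)" for n A
    unfolding h_def by (intro continuous_intros continuous_on_subset[OF g]) auto
  have hM: "\<bar>h n x\<bar> \<le> M" for n x using M0 by (auto simp: h_def)
  have "(\<lambda>n. inner_unit (\<lambda>x. f x - h n x) (\<lambda>x. f x - h n x)) \<longlonglongrightarrow> (LINT x|unit_measure. 0)"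
    unfolding inner_unit_def
  proof (rule integral_dominated_convergence[where w = "\<lambda>_. (2 * M) * (2 * M)"])
    show "(\<lambda>x. (f x - h n x) * (f x - h n x)) \<in> borel_measurable unit_measure" for n
      using L2_unitD(1)[OF f] continuous_imp_measurable_unit[OF h] by measurable
    show "integrable unit_measure (\<lambda>_. (2 * M) * (2 * M))"
      by (intro integrable_unit_continuous continuous_intros)
    have "AE x in lebesgue. x \<notin> N"
      using N by (auto simp: negligible_iff_null_sets intro: AE_not_in)
    then have "AE x in unit_measure. x \<notin> N"
      by (auto simp: AE_restrict_space_iff elim: eventually_mono)
    then show "AE x in unit_measure. (\<lambda>n. (f x - h n x) * (f x - h n x)) \<longlonglongrightarrow> 0"
    proof (rule AE_mp, intro AE_I2 impI)
      fix x assume x: "x \<in> space unit_measure" "x \<notin> N"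
      then have "(\<lambda>n. g n x) \<longlonglongrightarrow> f x" using lim[of x] by (simp add: F_def)
      then have "(\<lambda>n. (f x - h n x) * (f x - h n x)) \<longlonglongrightarrow>
        (f x - max (- M) (min M (f x))) * (f x - max (- M) (min M (f x)))"
        unfolding h_def by (intro tendsto_intros)
      moreover have "max (- M) (min M (f x)) = f x" using M[of x] by auto
      ultimately show "(\<lambda>n. (f x - h n x) * (f x - h n x)) \<longlonglongrightarrow> 0" by simp
    qed
    fix n
    have "\<bar>f x - h n x\<bar> \<le> 2 * M" for x using M[of x] hM[of n x] by linarith
    then have "\<bar>f x - h n x\<bar> * \<bar>f x - h n x\<bar> \<le> 2 * M * (2 * M)" for x
      using M0 by (intro mult_mono) auto
    then show "AE x in unit_measure. norm ((f x - h n x) * (f x - h n x)) \<le> (2 * M) * (2 * M)"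
      by (simp add: abs_mult)
  qed simp
  then have "\<forall>\<^sub>F n in sequentially. inner_unit (\<lambda>x. f x - h n x) (\<lambda>x. f x - h n x) < e"
    using e by (intro order_tendstoD(2)) auto
  then obtain n where "inner_unit (\<lambda>x. f x - h n x) (\<lambda>x. f x - h n x) < e"
    by (auto dest: eventually_happens)
  with h show ?thesis using that by blast
qed

text \<open>Truncation at height n converges to f in L2, dominated by \<open>(f x)\<^sup>2\<close>,
  and a truncation falls under the bounded case. Each error is kept below \<open>e / 4\<close> since
  the squared triangle inequality doubles both.\<close>

lemma L2_unit_continuous_approx:
  assumes f: "f \<in> L2_unit" and e: "0 < e"
  obtains g where "continuous_on UNIV g" "inner_unit (\<lambda>x. f x - g x) (\<lambda>x. f x - g x) < e"
proof -
  define F where "F n x = max (- real n) (min (real n) (f x))" for n :: nat and x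
  note [measurable] = L2_unitD(1)[OF f]
  have mF: "F n \<in> borel_measurable unit_measure" for n unfolding F_def by measurable
  note [measurable] = mF
  have F: "F n \<in> L2_unit" for n
  proof -
    have "integrable unit_measure (\<lambda>x. (F n x)\<^sup>2)"
    proof (rule integrable_unit_bounded[of _ "(real n)\<^sup>2"])
      have "\<bar>F n x\<bar> \<le> real n" for x by (auto simp: F_def)
      then show "\<bar>(F n x)\<^sup>2\<bar> \<le> (real n)\<^sup>2" for x
        by (metis abs_of_nat abs_power2 power2_le_iff_abs_le of_nat_0_le_iff power2_abs)
    qed measurable
    then show ?thesis by (simp add: L2_unit_def mF)
  qed
  have "(\<lambda>n. inner_unit (\<lambda>x. f x - F n x) (\<lambda>x. f x - F n x)) \<longlonglongrightarrow> (LINT x|unit_measure. 0)"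
    unfolding inner_unit_def
  proof (rule integral_dominated_convergence[where w = "\<lambda>x. (f x)\<^sup>2"])
    show "AE x in unit_measure. (\<lambda>n. (f x - F n x) * (f x - F n x)) \<longlonglongrightarrow> 0"
    proof (intro AE_I2 tendsto_eventually)
      fix x
      obtain n0 :: nat where "\<bar>f x\<bar> \<le> real n0" using real_arch_simple by blast
      then have "(f x - F n x) * (f x - F n x) = 0" if "n0 \<le> n" for n
        using that by (auto simp: F_def)
      then show "\<forall>\<^sub>F n in sequentially. (f x - F n x) * (f x - F n x) = 0"
        by (auto simp: eventually_sequentially)
    qed
    have "\<bar>f x - F n x\<bar> \<le> \<bar>f x\<bar>" for n x by (auto simp: F_def)
    then have "\<bar>f x - F n x\<bar> * \<bar>f x - F n x\<bar> \<le> \<bar>f x\<bar> * \<bar>f x\<bar>" for n x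
      by (intro mult_mono) auto
    then show "AE x in unit_measure. norm ((f x - F n x) * (f x - F n x)) \<le> (f x)\<^sup>2" for n
      by (simp add: abs_mult power2_eq_square)
  qed (use L2_unitD(2)[OF f] in auto)
  then have "\<forall>\<^sub>F n in sequentially. inner_unit (\<lambda>x. f x - F n x) (\<lambda>x. f x - F n x) < e / 4"
    using e by (intro order_tendstoD(2)) auto
  then obtain n where n: "inner_unit (\<lambda>x. f x - F n x) (\<lambda>x. f x - F n x) < e / 4"
    by (auto dest: eventually_happens)
  have "\<bar>F n x\<bar> \<le> real n" for x by (auto simp: F_def)
  then obtain g where g: "continuous_on UNIV g" "inner_unit (\<lambda>x. F n x - g x) (\<lambda>x. F n x - g x) < e / 4"
    using L2_unit_bounded_approx[OF F[of n], of "real n" "e / 4"] e by auto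
  have "g \<in> L2_unit" by (rule L2_unit_continuous[OF continuous_on_subset[OF g(1)]]) auto
  from inner_unit_self_diff_triangle[OF f F[of n] this] n g(2)
  have "inner_unit (\<lambda>x. f x - g x) (\<lambda>x. f x - g x) < e" by linarith
  with g(1) show ?thesis by (rule that)
qed

section \<open>Orthonormality and density of the cosines\<close>

lemma integral_cos_int_pi: "(LINT x|unit_measure. cos (of_int k * pi * x)) = (if k = 0 then 1 else 0)"
proof -
  have "(LINT x|unit_measure. cos (of_int k * pi * x)) = integral {0..1} (\<lambda>x. cos (of_int k * pi * x))"
    by (intro integral_unit_eq continuous_intros)
  also have "\<dots> = (if k = 0 then 1 else 0)"
  proof (cases "k = 0")
    case False
    have "((\<lambda>x. cos (of_int k * pi * x)) has_integral
        (sin (of_int k * pi * 1) / (of_int k * pi) - sin (of_int k * pi * 0) / (of_int k * pi))) {0..1}"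
      using False
      by (intro fundamental_theorem_of_calculus)
         (auto intro!: derivative_eq_intros simp flip: has_real_derivative_iff_has_vector_derivative)
    then show ?thesis
      using False by (simp add: integral_unique sin_zero_iff_int2)
  qed simp
  finally show ?thesis .
qed

definition cos_basis :: "nat \<Rightarrow> real \<Rightarrow> real" where
  "cos_basis n x = (if n = 0 then 1 else sqrt 2 * cos (real n * pi * x))"

lemma continuous_on_cos_basis [continuous_intros]: "continuous_on S (cos_basis n)"
  unfolding cos_basis_def by (cases "n = 0") (auto intro!: continuous_intros)

lemma cos_basis_L2: "cos_basis n \<in> L2_unit"
  by (intro L2_unit_continuous continuous_intros)

lemma abs_cos_basis_le: "\<bar>cos_basis n x\<bar> \<le> 2"
proof -
  have "sqrt 2 * \<bar>cos (real n * pi * x)\<bar> \<le> 2 * 1"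
    by (intro mult_mono) (auto simp: real_le_lsqrt sqrt2_less_2 less_imp_le)
  then show ?thesis by (simp add: cos_basis_def abs_mult)
qed

lemma cos_basis_orthonormal: "inner_unit (cos_basis m) (cos_basis n) = (if m = n then 1 else 0)"
proof -
  define \<kappa> :: "nat \<Rightarrow> real" where "\<kappa> k = (if k = 0 then 1 else sqrt 2)" for k
  have e: "cos_basis k x = \<kappa> k * cos (of_int (int k) * pi * x)" for k x
    by (simp add: cos_basis_def \<kappa>_def)
  have "cos (of_int (int m) * pi * x) * cos (of_int (int n) * pi * x)
      = (cos (of_int (int m - int n) * pi * x) + cos (of_int (int m + int n) * pi * x)) / 2" for x
    by (simp add: cos_times_cos algebra_simps)
  moreover have "cos_basis m x * cos_basis n x =
      \<kappa> m * \<kappa> n * (cos (of_int (int m) * pi * x) * cos (of_int (int n) * pi * x))" for x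
    unfolding e by (simp only: mult_ac)
  ultimately have "cos_basis m x * cos_basis n x =
      \<kappa> m * \<kappa> n / 2 * (cos (of_int (int m - int n) * pi * x) + cos (of_int (int m + int n) * pi * x))" for x
    by (simp only:) simp
  then have "inner_unit (cos_basis m) (cos_basis n) =
     \<kappa> m * \<kappa> n / 2 * (LINT x|unit_measure. cos (of_int (int m - int n) * pi * x) + cos (of_int (int m + int n) * pi * x))"
    by (simp only: inner_unit_def integral_mult_right_zero)
  also have "(LINT x|unit_measure. cos (of_int (int m - int n) * pi * x) + cos (of_int (int m + int n) * pi * x))
      = (if int m - int n = 0 then 1 else 0) + (if int m + int n = 0 then 1 else 0)"
    unfolding integral_cos_int_pi[symmetric]
    by (intro Bochner_Integration.integral_add integrable_unit_continuous continuous_intros)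
  \<comment> \<open>The sum frequency counts only for m = n = 0, where both integrals are 1 and
    \<open>\<kappa> 0 = 1\<close>; for m = n > 0 only the difference frequency counts, and the
    square of \<open>sqrt 2\<close> cancels the 1/2.\<close>
  also have "int m + int n = 0 \<longleftrightarrow> m = 0 \<and> n = 0" by linarith
  finally show ?thesis by (auto simp: \<kappa>_def split: if_splits)
qed

text \<open>The linear span of the cosines, given by generators so that closure under products can
  be proved by induction. Polynomials in \<open>cos (pi * x)\<close> then belong to it.\<close>

inductive cos_poly :: "(real \<Rightarrow> real) \<Rightarrow> bool" where
  basis: "cos_poly (\<lambda>x. cos (real n * pi * x))"
| add: "cos_poly f \<Longrightarrow> cos_poly g \<Longrightarrow> cos_poly (\<lambda>x. f x + g x)"
| scale: "cos_poly f \<Longrightarrow> cos_poly (\<lambda>x. c * f x)"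

lemma cos_poly_const: "cos_poly (\<lambda>x. c)"
  using cos_poly.scale[OF cos_poly.basis[of 0], of c] by simp

lemma cos_poly_mult:
  assumes "cos_poly f" "cos_poly g"
  shows "cos_poly (\<lambda>x. f x * g x)"
  using assms
proof (induction f arbitrary: g rule: cos_poly.induct)
  case (basis m)
  then show ?case
  proof (induction g rule: cos_poly.induct)
    case (basis n)
    \<comment> \<open>Frequencies in \<open>cos_poly\<close> are natural numbers; as the cosine is
      even, \<open>m - n\<close> may be replaced by its absolute value.\<close>
    define d where "d = nat \<bar>int m - int n\<bar>"
    have d: "cos (real d * pi * x) = cos (real m * pi * x - real n * pi * x)" for x
    proof (cases "n \<le> m")
      case True
      then show ?thesis by (simp add: d_def of_nat_diff nat_diff_distrib algebra_simps)
    next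
      case False
      then have "real d * pi * x = - (real m * pi * x - real n * pi * x)"
        by (simp add: d_def of_nat_diff algebra_simps)
      then show ?thesis by (metis cos_minus)
    qed
    have "cos (real m * pi * x) * cos (real n * pi * x)
       = 1/2 * (cos (real d * pi * x) + cos (real (m + n) * pi * x))" for x
      unfolding d by (simp add: cos_times_cos distrib_right)
    then show ?case
      by (simp only:) (intro cos_poly.intros)
  next
    case (add f g)
    then show ?case by (simp only: distrib_left) (intro cos_poly.add)
  next
    case (scale f c)
    then show ?case by (simp only: mult.left_commute[of _ c]) (intro cos_poly.scale)
  qed
next
  case (add f1 f2)
  then show ?case by (simp only: distrib_right) (intro cos_poly.add)
next
  case (scale f c)
  then show ?case by (simp only: mult.assoc) (intro cos_poly.scale)
qed

lemma cos_poly_polynomial_cos: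
  assumes "real_polynomial_function (p :: real \<Rightarrow> real)"
  shows "cos_poly (\<lambda>x. p (cos (pi * x)))"
  using assms
proof (induction p rule: real_polynomial_function.induct)
  case (linear f)
  then have "f y = f 1 * y" for y
    by (metis linear_simps(5) mult.commute mult.right_neutral real_scaleR_def)
  moreover have "cos_poly (\<lambda>x. f 1 * cos (pi * x))"
    using cos_poly.scale[OF cos_poly.basis[of 1]] by simp
  ultimately show ?case by (metis (no_types, lifting) ext)
next
  case (const c)
  then show ?case by (rule cos_poly_const)
next
  case (add f g)
  then show ?case by (intro cos_poly.add)
next
  case (mult f g)
  then show ?case by (intro cos_poly_mult)
qed

lemma cos_poly_basis_expansion:
  assumes "cos_poly f"
  shows "\<exists>N p. (\<forall>n>N. p n = 0) \<and> (\<forall>x. f x = (\<Sum>n\<le>N. p n * cos_basis n x))"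
  using assms
proof (induction rule: cos_poly.induct)
  case (basis m)
  let ?p = "\<lambda>n. if n = m then (if m = 0 then 1 else 1 / sqrt 2) else 0 :: real"
  have "(\<Sum>n\<le>m. ?p n * cos_basis n x) = ?p m * cos_basis m x" for x
    by (simp add: if_distrib[of "\<lambda>c. c * _"] cong: if_cong)
  then have "cos (real m * pi * x) = (\<Sum>n\<le>m. ?p n * cos_basis n x)" for x
    by (simp add: cos_basis_def)
  then show ?case by (intro exI[of _ m] exI[of _ ?p]) auto
next
  case (add f g)
  then obtain N p N' p' where *: "\<forall>n>N. p n = 0" "\<And>x. f x = (\<Sum>n\<le>N. p n * cos_basis n x)"
    "\<forall>n>N'. p' n = 0" "\<And>x. g x = (\<Sum>n\<le>N'. p' n * cos_basis n x)" by blast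
  \<comment> \<open>Zero coefficients beyond N and N' let both sums be extended to a common
    length.\<close>
  have "(\<Sum>n\<le>N. p n * cos_basis n x) = (\<Sum>n\<le>max N N'. p n * cos_basis n x)"
    "(\<Sum>n\<le>N'. p' n * cos_basis n x) = (\<Sum>n\<le>max N N'. p' n * cos_basis n x)" for x
    using *(1,3) by (auto intro!: sum.mono_neutral_left) (meson leI)+
  then have "f x + g x = (\<Sum>n\<le>max N N'. (p n + p' n) * cos_basis n x)" for x
    using *(2,4) by (simp add: distrib_right sum.distrib)
  moreover have "\<forall>n>max N N'. p n + p' n = 0" using *(1,3) by auto
  ultimately show ?case
    by (intro exI[of _ "max N N'"] exI[of _ "\<lambda>n. p n + p' n"] conjI allI) simp_all
next
  case (scale f c)
  then obtain N p where *: "\<forall>n>N. p n = 0" "\<And>x. f x = (\<Sum>n\<le>N. p n * cos_basis n x)" by blast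
  have "c * f x = (\<Sum>n\<le>N. (c * p n) * cos_basis n x)" for x
    by (simp add: *(2) sum_distrib_left mult.assoc)
  moreover have "\<forall>n>N. c * p n = 0" using * by auto
  ultimately show ?case
    by (intro exI[of _ N] exI[of _ "\<lambda>n. c * p n"] conjI allI) simp_all
qed

text \<open>The substitution \<open>y = cos (pi * x)\<close> maps [0, 1] bijectively onto [-1, 1],
  so a polynomial in y approximating g there is a polynomial in \<open>cos (pi * x)\<close>, hence a
  cosine sum.\<close>

lemma cos_basis_uniform_approx:
  assumes "continuous_on {0..1} g" "0 < e"
  obtains N p where "\<And>x. 0 \<le> x \<Longrightarrow> x \<le> 1 \<Longrightarrow> \<bar>g x - (\<Sum>n\<le>N. p n * cos_basis n x)\<bar> < e"
proof -
  have "continuous_on {-1..1} (\<lambda>y. g (arccos y / pi))"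
  proof (rule continuous_on_compose2[OF assms(1)])
    show "continuous_on {-1..1} (\<lambda>y. arccos y / pi)"
      by (intro continuous_intros) auto
    show "(\<lambda>y. arccos y / pi) ` {-1..1} \<subseteq> {0..1}"
      by (auto simp: arccos_lbound arccos_ubound)
  qed
  then obtain P where P: "real_polynomial_function P"
    "\<And>y. y \<in> {-1..1} \<Longrightarrow> \<bar>g (arccos y / pi) - P y\<bar> < e"
    using Stone_Weierstrass_real_polynomial_function[of "{-1..1}" "\<lambda>y. g (arccos y / pi)" e] assms(2)
    by auto
  obtain N p where p: "\<And>x. P (cos (pi * x)) = (\<Sum>n\<le>N. p n * cos_basis n x)"
    using cos_poly_basis_expansion[OF cos_poly_polynomial_cos[OF P(1)]] by blast
  show ?thesis
  proof (rule that)
    fix x :: real assume x: "0 \<le> x" "x \<le> 1"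
    then have "arccos (cos (pi * x)) = pi * x"
      by (intro arccos_cos) auto
    with P(2)[of "cos (pi * x)"] show "\<bar>g x - (\<Sum>n\<le>N. p n * cos_basis n x)\<bar> < e"
      by (simp add: p)
  qed
qed

section \<open>Bessel's inequality and Parseval's identity\<close>

abbreviation cos_coefficient :: "(real \<Rightarrow> real) \<Rightarrow> nat \<Rightarrow> real" where
  "cos_coefficient f n \<equiv> inner_unit f (cos_basis n)"

lemma inner_unit_cos_basis_sum:
  "inner_unit (\<lambda>x. \<Sum>n\<le>N. p n * cos_basis n x) (cos_basis m) = (if m \<le> N then p m else 0)"
  by (simp add: inner_unit_sum_left L2_unit_scale cos_basis_L2 inner_unit_scale_left cos_basis_orthonormal
      if_distrib[of "\<lambda>c. _ * c"] cong: if_cong)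

text \<open>Completing the square in each coefficient. With p the cosine coefficients this gives
  Bessel's inequality; with arbitrary p it shows that no other cosine sum up to N comes closer to
  f.\<close>

lemma inner_unit_dist_cos_sum:
  fixes N :: nat and p :: "nat \<Rightarrow> real"
  assumes f: "f \<in> L2_unit"
  defines "S \<equiv> \<lambda>x. \<Sum>n\<le>N. p n * cos_basis n x"
  shows "inner_unit (\<lambda>x. f x - S x) (\<lambda>x. f x - S x)
     = inner_unit f f - (\<Sum>n\<le>N. (cos_coefficient f n)\<^sup>2) + (\<Sum>n\<le>N. (p n - cos_coefficient f n)\<^sup>2)"
proof -
  have S: "S \<in> L2_unit"
    unfolding S_def by (intro L2_unit_sum L2_unit_scale cos_basis_L2)
  have sum: "inner_unit S h = (\<Sum>n\<le>N. p n * inner_unit h (cos_basis n))" if "h \<in> L2_unit" for h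
    unfolding S_def inner_unit_commute[of h] using that
    by (simp add: inner_unit_sum_left L2_unit_scale cos_basis_L2 inner_unit_scale_left)
  have "inner_unit S S = (\<Sum>n\<le>N. p n * p n)"
    unfolding sum[OF S] unfolding S_def inner_unit_cos_basis_sum by (intro sum.cong) auto
  moreover have "inner_unit f S = (\<Sum>n\<le>N. p n * cos_coefficient f n)"
    using sum[OF f] by (simp add: inner_unit_commute)
  ultimately have "inner_unit (\<lambda>x. f x - S x) (\<lambda>x. f x - S x)
     = inner_unit f f - 2 * (\<Sum>n\<le>N. p n * cos_coefficient f n) + (\<Sum>n\<le>N. p n * p n)"
    by (simp add: inner_unit_self_diff[OF f S])
  also have "\<dots> = inner_unit f f + (\<Sum>n\<le>N. p n * p n - 2 * (p n * cos_coefficient f n))"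
    by (simp add: sum_subtractf sum_distrib_left)
  also have "\<dots> = inner_unit f f - (\<Sum>n\<le>N. (cos_coefficient f n)\<^sup>2) + (\<Sum>n\<le>N. (p n - cos_coefficient f n)\<^sup>2)"
  proof -
    have "(\<Sum>n\<le>N. (p n - cos_coefficient f n)\<^sup>2) - (\<Sum>n\<le>N. (cos_coefficient f n)\<^sup>2)
        = (\<Sum>n\<le>N. p n * p n - 2 * (p n * cos_coefficient f n))"
      unfolding sum_subtractf[symmetric] by (intro sum.cong) (auto simp: power2_eq_square algebra_simps)
    then show ?thesis by linarith
  qed
  finally show ?thesis .
qed

text \<open>Bessel's inequality bounds the partial sums from above. Conversely, a cosine sum close
  to f forces them close to \<open>inner_unit f f\<close>, and such sums exist by the two density
  results.\<close>

lemma parseval: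
  assumes f: "f \<in> L2_unit"
  shows "(\<lambda>n. (cos_coefficient f n)\<^sup>2) sums inner_unit f f"
proof -
  let ?A = "\<lambda>N. \<Sum>n\<le>N. (cos_coefficient f n)\<^sup>2"
  have le: "?A N \<le> inner_unit f f" for N
    using inner_unit_dist_cos_sum[OF f, where N = N and p = "cos_coefficient f"]
      inner_unit_nonneg[of "\<lambda>x. f x - (\<Sum>n\<le>N. cos_coefficient f n * cos_basis n x)"] by simp
  have ev: "\<exists>N. \<forall>n\<ge>N. inner_unit f f - e < ?A n" if e: "0 < e" for e
  proof -
    obtain g where g: "continuous_on UNIV g" "inner_unit (\<lambda>x. f x - g x) (\<lambda>x. f x - g x) < e / 4"
      using L2_unit_continuous_approx[OF f, of "e / 4"] e by auto
    have g01: "continuous_on {0..1} g" by (rule continuous_on_subset[OF g(1)]) auto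
    have gL: "g \<in> L2_unit" by (rule L2_unit_continuous[OF g01])
    \<comment> \<open>The interval has length 1, so uniform distance d means squared distance at
      most \<open>d * d\<close>, which is at most \<open>e / 4\<close>.\<close>
    define d where "d = min 1 (e / 4)"
    have d: "0 < d" "d * d \<le> e / 4"
    proof -
      show "0 < d" using e by (simp add: d_def)
      then have "d * d \<le> 1 * d" by (intro mult_right_mono) (auto simp: d_def)
      then show "d * d \<le> e / 4" by (simp add: d_def)
    qed
    obtain N p where p: "\<And>x. 0 \<le> x \<Longrightarrow> x \<le> 1 \<Longrightarrow> \<bar>g x - (\<Sum>n\<le>N. p n * cos_basis n x)\<bar> < d"
      using cos_basis_uniform_approx[OF g01 d(1)] by metis
    define P where "P x = (\<Sum>n\<le>N. p n * cos_basis n x)" for x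
    have P: "continuous_on {0..1} P"
      unfolding P_def by (intro continuous_intros)
    have "inner_unit (\<lambda>x. g x - P x) (\<lambda>x. g x - P x) \<le> (LINT x|unit_measure. d * d)"
      unfolding inner_unit_def
    proof (intro integral_mono integrable_unit_continuous continuous_intros g01 P)
      fix x assume "x \<in> space unit_measure"
      then have "\<bar>g x - P x\<bar> * \<bar>g x - P x\<bar> \<le> d * d"
        using p[of x] by (intro mult_mono) (auto simp: P_def less_imp_le)
      then show "(g x - P x) * (g x - P x) \<le> d * d" by (simp flip: abs_mult)
    qed
    also have "\<dots> \<le> e / 4"
      using d(2) by (subst integral_unit_eq) auto
    finally have "inner_unit (\<lambda>x. f x - P x) (\<lambda>x. f x - P x) < e"
      using inner_unit_self_diff_triangle[OF f gL L2_unit_continuous[OF P]] g(2) by linarith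
    then have "inner_unit f f - ?A N + (\<Sum>n\<le>N. (p n - cos_coefficient f n)\<^sup>2) < e"
      using inner_unit_dist_cos_sum[OF f, where N = N and p = p] by (simp add: P_def)
    moreover have "0 \<le> (\<Sum>n\<le>N. (p n - cos_coefficient f n)\<^sup>2)" by (intro sum_nonneg) auto
    ultimately have "inner_unit f f - e < ?A N" by linarith
    moreover have "?A N \<le> ?A n" if "N \<le> n" for n
      using that by (intro sum_mono2) auto
    ultimately show ?thesis by (intro exI[of _ N]) (auto intro: less_le_trans)
  qed
  have "?A \<longlonglongrightarrow> inner_unit f f"
  proof (rule LIMSEQ_I)
    fix e :: real assume "0 < e"
    from ev[OF this] obtain N where "\<forall>n\<ge>N. inner_unit f f - e < ?A n" ..
    with le show "\<exists>N. \<forall>n\<ge>N. norm (?A n - inner_unit f f) < e"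
      by (intro exI[of _ N] allI impI) (smt (verit) real_norm_def)
  qed
  then show ?thesis by (simp add: sums_def_le)
qed

lemma L2_zero_if_cos_coefficients_zero:
  assumes "f \<in> L2_unit" "\<And>n. cos_coefficient f n = 0"
  shows "AE x in unit_measure. f x = 0"
proof (rule inner_unit_self_zero[OF assms(1)])
  show "inner_unit f f = 0"
    using sums_unique[OF parseval[OF assms(1)]] assms(2) by simp
qed

lemma abs_cos_coefficient_le:
  assumes "f \<in> L2_unit"
  shows "\<bar>cos_coefficient f n\<bar> \<le> sqrt (inner_unit f f)"
  using inner_unit_Cauchy_Schwarz[OF assms cos_basis_L2, of n] by (simp add: cos_basis_orthonormal)

section \<open>The free heat flow in L2\<close>

lemma cos_basis_eq: "cos_basis n x = cos_basis n 0 * cos (real n * pi * x)"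
  by (simp add: cos_basis_def)

text \<open>The factor \<open>cos_basis n 0\<close> undoes the normalisation of the basis: these are
  the coefficients of f with respect to the plain \<open>cos (real n * pi * x)\<close>, as
  \<open>heat_trace\<close> expects.\<close>

definition free_coeffs :: "(real \<Rightarrow> real) \<Rightarrow> nat \<Rightarrow> real" where
  "free_coeffs f n = cos_coefficient f n * cos_basis n 0"

lemma bounded_free_coeffs:
  assumes "f \<in> L2_unit"
  shows "bounded_coeffs (free_coeffs f) (sqrt (inner_unit f f) * 2)"
proof
  show "\<bar>free_coeffs f n\<bar> \<le> sqrt (inner_unit f f) * 2" for n
    unfolding free_coeffs_def abs_mult
    by (intro mult_mono abs_cos_coefficient_le[OF assms] abs_cos_basis_le) (auto simp: inner_unit_nonneg)
qed

definition free_heat :: "(real \<Rightarrow> real) \<Rightarrow> real \<Rightarrow> real \<Rightarrow> real" where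
  "free_heat f t x = (\<Sum>n. cos_coefficient f n * exp (- eigval n * t) * cos_basis n x)"

lemma flat_series_free:
  assumes "f \<in> L2_unit" "0 < t"
  shows "flat_series (heat_trace (free_coeffs f)) 0 t x = free_heat f t x"
  using bounded_coeffs.flat_series_heat_trace_0[OF bounded_free_coeffs[OF assms(1)] assms(2), of x]
  unfolding free_heat_def cos_basis_eq[of _ x] by (simp add: free_coeffs_def mult_ac)

lemma summable_coeff_exp:
  assumes "f \<in> L2_unit" "0 < t"
  shows "summable (\<lambda>n. sqrt (inner_unit f f) * exp (- eigval n * t) * B)"
  by (intro summable_mult2 summable_mult summable_exp_eigval assms)

lemma free_heat_term_le:
  assumes "f \<in> L2_unit"
  shows "\<bar>cos_coefficient f n * exp (- eigval n * t) * cos_basis n x\<bar> \<le> sqrt (inner_unit f f) * exp (- eigval n * t) * 2"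
  unfolding abs_mult
  by (intro mult_mono abs_cos_coefficient_le[OF assms] abs_cos_basis_le) (auto simp: inner_unit_nonneg)

lemma continuous_on_free_heat:
  assumes "f \<in> L2_unit" "0 < t"
  shows "continuous_on {0..1} (free_heat f t)"
proof (rule uniform_limit_theorem)
  show "uniform_limit {0..1} (\<lambda>N x. \<Sum>n<N. cos_coefficient f n * exp (- eigval n * t) * cos_basis n x)
      (free_heat f t) sequentially"
    unfolding free_heat_def[abs_def]
    by (rule Weierstrass_m_test[OF _ summable_coeff_exp[OF assms, of 2]])
       (use free_heat_term_le[OF assms(1)] in auto)
  show "\<forall>\<^sub>F N in sequentially. continuous_on {0..1}
      (\<lambda>x. \<Sum>n<N. cos_coefficient f n * exp (- eigval n * t) * cos_basis n x)"
    by (intro always_eventually allI continuous_intros)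
qed simp

text \<open>The series has a summable majorant uniform in x, so it may be integrated termwise, and
  orthonormality keeps one term. The heat flow is thus diagonal in the cosines.\<close>

lemma cos_coefficient_free_heat:
  assumes "f \<in> L2_unit" "0 < t"
  shows "cos_coefficient (free_heat f t) m = cos_coefficient f m * exp (- eigval m * t)"
proof -
  let ?h = "\<lambda>n x. cos_coefficient f n * exp (- eigval n * t) * cos_basis n x * cos_basis m x"
  have cont: "continuous_on {0..1} (?h n)" for n by (intro continuous_intros)
  have le: "norm (?h n x) \<le> sqrt (inner_unit f f) * exp (- eigval n * t) * 4" for n x
  proof -
    have "norm (?h n x) \<le> sqrt (inner_unit f f) * exp (- eigval n * t) * 2 * 2"
      unfolding real_norm_def abs_mult[of _ "cos_basis m x"]
      by (intro mult_mono free_heat_term_le[OF assms(1)] abs_cos_basis_le) (auto simp: inner_unit_nonneg)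
    then show ?thesis by simp
  qed
  have "(\<lambda>n. LINT x|unit_measure. ?h n x) sums (LINT x|unit_measure. (\<Sum>n. ?h n x))"
  proof (rule sums_integral)
    show "integrable unit_measure (?h n)" for n by (intro integrable_unit_continuous cont)
    show "AE x in unit_measure. summable (\<lambda>n. norm (?h n x))"
      by (intro AE_I2 summable_comparison_test'[OF summable_coeff_exp[OF assms, of 4], of 0])
         (use le in auto)
    show "summable (\<lambda>n. LINT x|unit_measure. norm (?h n x))"
    proof (rule summable_comparison_test'[OF summable_coeff_exp[OF assms, of 4], of 0])
      fix n
      have "(LINT x|unit_measure. norm (?h n x)) \<le> (LINT x|unit_measure. sqrt (inner_unit f f) * exp (- eigval n * t) * 4)"
        by (intro integral_mono integrable_unit_continuous continuous_intros le)
      also have "\<dots> = sqrt (inner_unit f f) * exp (- eigval n * t) * 4"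
        by (subst integral_unit_eq) auto
      finally show "norm (LINT x|unit_measure. norm (?h n x)) \<le> sqrt (inner_unit f f) * exp (- eigval n * t) * 4"
        by (subst real_norm_def, subst abs_of_nonneg) (auto intro!: integral_nonneg_AE)
    qed
  qed
  also have "(\<lambda>n. LINT x|unit_measure. ?h n x) = (\<lambda>n. if n = m then cos_coefficient f m * exp (- eigval m * t) else 0)"
  proof
    fix n
    have "(LINT x|unit_measure. ?h n x) = cos_coefficient f n * exp (- eigval n * t) * inner_unit (cos_basis n) (cos_basis m)"
      by (simp add: inner_unit_def mult.assoc)
    then show "(LINT x|unit_measure. ?h n x) = (if n = m then cos_coefficient f m * exp (- eigval m * t) else 0)"
      by (simp add: cos_basis_orthonormal)
  qed
  also have "(\<lambda>x. \<Sum>n. ?h n x) = (\<lambda>x. free_heat f t x * cos_basis m x)"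
    unfolding free_heat_def
    by (rule ext, rule suminf_mult2[symmetric])
       (rule summable_comparison_test'[OF summable_coeff_exp[OF assms, of 2], of 0],
        use free_heat_term_le[OF assms(1)] in auto)
  finally have "(\<lambda>n. if n = m then cos_coefficient f m * exp (- eigval m * t) else 0) sums cos_coefficient (free_heat f t) m"
    by (simp only: inner_unit_def)
  then show ?thesis
    using sums_single[of m "\<lambda>_. cos_coefficient f m * exp (- eigval m * t)"] sums_unique2 by blast
qed

text \<open>Parseval's identity turns the squared distance into a series in n. It is dominated by
  the squared coefficients of f uniformly in \<open>t \<ge> 0\<close>, hence continuous up to t = 0,
  where it vanishes.\<close>

lemma free_heat_tendsto_initial:
  assumes f: "f \<in> L2_unit"
  shows "((\<lambda>t. inner_unit (\<lambda>x. free_heat f t x - f x) (\<lambda>x. free_heat f t x - f x)) \<longlongrightarrow> 0) (at_right 0)"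
proof -
  let ?g = "\<lambda>t. \<Sum>n. (cos_coefficient f n * (exp (- eigval n * t) - 1))\<^sup>2"
  have "continuous_on {0..} ?g"
  proof (rule uniform_limit_theorem)
    show "uniform_limit {0..} (\<lambda>N t. \<Sum>n<N. (cos_coefficient f n * (exp (- eigval n * t) - 1))\<^sup>2) ?g sequentially"
    proof (rule Weierstrass_m_test)
      show "summable (\<lambda>n. (cos_coefficient f n)\<^sup>2)" using parseval[OF f] by (rule sums_summable)
      fix n and t :: real assume "t \<in> {0..}"
      then have "exp (- eigval n * t) \<le> 1" by simp
      then have "\<bar>exp (- eigval n * t) - 1\<bar> \<le> 1" using exp_gt_zero[of "- eigval n * t"] by linarith
      then have "(exp (- eigval n * t) - 1)\<^sup>2 \<le> 1" by (simp add: abs_square_le_1)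
      then have "(cos_coefficient f n)\<^sup>2 * (exp (- eigval n * t) - 1)\<^sup>2 \<le> (cos_coefficient f n)\<^sup>2 * 1"
        by (intro mult_left_mono) auto
      then show "norm ((cos_coefficient f n * (exp (- eigval n * t) - 1))\<^sup>2) \<le> (cos_coefficient f n)\<^sup>2"
        by (simp add: power_mult_distrib)
    qed
    show "\<forall>\<^sub>F N in sequentially. continuous_on {0..} (\<lambda>t. \<Sum>n<N. (cos_coefficient f n * (exp (- eigval n * t) - 1))\<^sup>2)"
      by (intro always_eventually allI continuous_intros)
  qed simp
  then have "(?g \<longlongrightarrow> ?g 0) (at 0 within {0..})"
    unfolding continuous_on_def by (rule bspec) simp
  then have "(?g \<longlongrightarrow> ?g 0) (at_right 0)"
    by (rule tendsto_within_subset) auto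
  then have lim: "(?g \<longlongrightarrow> 0) (at_right 0)" by simp
  have "?g t = inner_unit (\<lambda>x. free_heat f t x - f x) (\<lambda>x. free_heat f t x - f x)" if t: "0 < t" for t
  proof -
    have L: "free_heat f t \<in> L2_unit" by (intro L2_unit_continuous continuous_on_free_heat f t)
    have "cos_coefficient (\<lambda>x. free_heat f t x - f x) n = cos_coefficient f n * (exp (- eigval n * t) - 1)" for n
      by (simp add: inner_unit_diff_left L f cos_basis_L2 cos_coefficient_free_heat t algebra_simps)
    then show ?thesis
      using sums_unique[OF parseval[OF L2_unit_diff[OF L f]]] by simp
  qed
  then have "\<forall>\<^sub>F t in at_right 0. ?g t = inner_unit (\<lambda>x. free_heat f t x - f x) (\<lambda>x. free_heat f t x - f x)"
    by (auto simp: eventually_at_filter)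
  from tendsto_cong[OF this] lim show ?thesis by simp
qed

section \<open>Weak solutions\<close>

lemma continuous_into_L2_inner:
  assumes \<theta>: "continuous_into_L2 T \<theta>" and g: "g \<in> L2_unit"
  shows "continuous_on {0..T} (\<lambda>t. inner_unit (\<theta> t) g)"
  unfolding continuous_on_def
proof
  fix t assume t: "t \<in> {0..T}"
  have L: "\<theta> r \<in> L2_unit" if "r \<in> {0..T}" for r
    using \<theta> that by (simp add: continuous_into_L2_def)
  have "((\<lambda>r. inner_unit (\<theta> r) g - inner_unit (\<theta> t) g) \<longlongrightarrow> 0) (at t within {0..T})"
  proof (rule Lim_null_comparison)
    show "\<forall>\<^sub>F r in at t within {0..T}. norm (inner_unit (\<theta> r) g - inner_unit (\<theta> t) g)
        \<le> L2_norm_unit (\<lambda>x. \<theta> r x - \<theta> t x) * sqrt (inner_unit g g)"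
      unfolding eventually_at_filter
    proof (intro always_eventually allI impI)
      fix r assume r: "r \<in> {0..T}"
      have "inner_unit (\<theta> r) g - inner_unit (\<theta> t) g = inner_unit (\<lambda>x. \<theta> r x - \<theta> t x) g"
        by (rule inner_unit_diff_left[symmetric]) (use L r t g in auto)
      then show "norm (inner_unit (\<theta> r) g - inner_unit (\<theta> t) g)
        \<le> L2_norm_unit (\<lambda>x. \<theta> r x - \<theta> t x) * sqrt (inner_unit g g)"
        using inner_unit_Cauchy_Schwarz[OF L2_unit_diff[OF L[OF r] L[OF t]] g] by (simp add: L2_norm_unit_eq)
    qed
    have "((\<lambda>r. L2_norm_unit (\<lambda>x. \<theta> r x - \<theta> t x)) \<longlongrightarrow> 0) (at t within {0..T})"
      using \<theta> t by (simp add: continuous_into_L2_def)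
    then show "((\<lambda>r. L2_norm_unit (\<lambda>x. \<theta> r x - \<theta> t x) * sqrt (inner_unit g g)) \<longlongrightarrow> 0) (at t within {0..T})"
      by (rule tendsto_mult_left_zero)
  qed
  then show "((\<lambda>t. inner_unit (\<theta> t) g) \<longlongrightarrow> inner_unit (\<theta> t) g) (at t within {0..T})"
    by (simp add: LIM_zero_iff)
qed

lemma heat_solutionD:
  assumes "heat_solution T \<theta>0 u \<theta>" "neumann_test \<phi> \<phi>1 \<phi>2" "t \<in> {0..T}"
  shows "inner_unit (\<theta> t) \<phi> = inner_unit \<theta>0 \<phi> + (LINT r|lebesgue_on {0..t}. inner_unit (\<theta> r) \<phi>2 + u r * \<phi> 1)"
  using assms unfolding heat_solution_def inner_unit_def by blast

lemma neumann_test_cos_basis: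
  "neumann_test (cos_basis n) (\<lambda>x. - real n * pi * (cos_basis n 0 * sin (real n * pi * x)))
     (\<lambda>x. - eigval n * cos_basis n x)"
proof -
  have b: "cos_basis n = (\<lambda>x. cos_basis n 0 * cos (real n * pi * x))"
    using cos_basis_eq by blast
  have "(cos_basis n has_real_derivative - real n * pi * (cos_basis n 0 * sin (real n * pi * x))) (at x within S)" for x S
    by (subst b) (auto intro!: derivative_eq_intros)
  moreover have "((\<lambda>x. - real n * pi * (cos_basis n 0 * sin (real n * pi * x))) has_real_derivative
      - eigval n * cos_basis n x) (at x within S)" for x S
    by (subst (2) b) (auto intro!: derivative_eq_intros simp: eigval_def power2_eq_square)
  ultimately show ?thesis
    by (auto simp: neumann_test_def intro!: continuous_intros)
qed

text \<open>The integral equation makes d differentiable with derivative \<open>c * d t\<close>, so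
  \<open>exp (- c * t)\<close> is an integrating factor; the resulting constant is the value at 0,
  an integral over a single point.\<close>

lemma linear_ode_zero:
  fixes d :: "real \<Rightarrow> real"
  assumes d: "continuous_on {0..T} d" and eq: "\<And>t. t \<in> {0..T} \<Longrightarrow> d t = integral {0..t} (\<lambda>r. c * d r)"
    and t: "t \<in> {0..T}"
  shows "d t = 0"
proof -
  have "((\<lambda>t. integral {0..t} (\<lambda>r. c * d r)) has_real_derivative c * d t) (at t within {0..T})"
    if "t \<in> {0..T}" for t
    by (rule integral_has_real_derivative) (use that d in \<open>auto intro!: continuous_intros\<close>)
  then have der: "(d has_real_derivative c * d t) (at t within {0..T})" if "t \<in> {0..T}" for t
    unfolding has_field_derivative_def
    by (rule has_derivative_transform[rotated 2]) (use that eq in auto)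
  have "((\<lambda>t. d t * exp (- c * t)) has_real_derivative 0) (at t within {0..T})" if "t \<in> {0..T}" for t
    by (rule derivative_eq_intros der[OF that] refl)+ (simp add: algebra_simps)
  then obtain k where k: "\<And>t. t \<in> {0..T} \<Longrightarrow> d t * exp (- c * t) = k"
    using has_field_derivative_zero_constant[of "{0..T}" "\<lambda>t. d t * exp (- c * t)"] by auto
  have "0 \<in> {0..T}" using t by simp
  from k[OF this] eq[OF this] have "k = 0" by simp
  with k[OF t] show ?thesis by simp
qed

text \<open>For a cosine test function the second derivative is a multiple of the function itself,
  so each coefficient of the difference solves a scalar linear equation with initial value 0; the
  control terms cancel.\<close>

lemma heat_solution_unique:
  assumes 1: "heat_solution T \<theta>0 u \<theta>" and 2: "heat_solution T \<theta>0 u \<theta>'" and t: "t \<in> {0..T}"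
  shows "AE x in unit_measure. \<theta> t x = \<theta>' t x"
proof -
  have u: "integrable (lebesgue_on {0..T}) u" using 1 by (simp add: heat_solution_def)
  have c: "continuous_into_L2 T \<theta>" "continuous_into_L2 T \<theta>'" using 1 2 by (auto simp: heat_solution_def)
  have L: "\<theta> t \<in> L2_unit" "\<theta>' t \<in> L2_unit" using c t by (auto simp: continuous_into_L2_def)
  have "cos_coefficient (\<theta> t) n - cos_coefficient (\<theta>' t) n = 0" for n
  proof (rule linear_ode_zero[where d = "\<lambda>t. cos_coefficient (\<theta> t) n - cos_coefficient (\<theta>' t) n" and c = "- eigval n"])
    have cont: "continuous_on {0..T} (\<lambda>t. cos_coefficient (\<theta> t) n)" "continuous_on {0..T} (\<lambda>t. cos_coefficient (\<theta>' t) n)"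
      by (intro continuous_into_L2_inner c cos_basis_L2)+
    then show "continuous_on {0..T} (\<lambda>t. cos_coefficient (\<theta> t) n - cos_coefficient (\<theta>' t) n)"
      by (intro continuous_intros)
    fix t assume t: "t \<in> {0..T}"
    let ?M = "lebesgue_on {0..t}"
    have u': "integrable ?M u"
    proof -
      have "set_integrable lebesgue {0..T} u"
        using u by (simp add: integrable_restrict_space set_integrable_def)
      then have "set_integrable lebesgue {0..t} u"
        by (rule set_integrable_subset) (use t in auto)
      then show ?thesis by (simp add: integrable_restrict_space set_integrable_def)
    qed
    have i: "integrable ?M (\<lambda>r. cos_coefficient (\<theta> r) n)" "integrable ?M (\<lambda>r. cos_coefficient (\<theta>' r) n)"
      by (intro continuous_imp_integrable_real continuous_on_subset[OF cont(1)] continuous_on_subset[OF cont(2)], use t in auto)+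
    have s: "inner_unit g (\<lambda>x. - eigval n * cos_basis n x) = - eigval n * cos_coefficient g n" for g
      by (simp only: inner_unit_commute[of g] inner_unit_scale_left)
    note i' = i[THEN integrable_mult_right, of "- eigval n"] integrable_mult_left[OF u', of "cos_basis n 1"]
    have "cos_coefficient (\<theta> t) n - cos_coefficient (\<theta>' t) n
        = (LINT r|?M. - eigval n * cos_coefficient (\<theta> r) n + u r * cos_basis n 1)
          - (LINT r|?M. - eigval n * cos_coefficient (\<theta>' r) n + u r * cos_basis n 1)"
      using heat_solutionD[OF 1 neumann_test_cos_basis t, of n] heat_solutionD[OF 2 neumann_test_cos_basis t, of n]
      unfolding s by linarith
    also have "\<dots> = (LINT r|?M. - eigval n * (cos_coefficient (\<theta> r) n - cos_coefficient (\<theta>' r) n))"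
      using i' by (simp add: right_diff_distrib del: mult_minus_left)
    also have "\<dots> = integral {0..t} (\<lambda>r. - eigval n * (cos_coefficient (\<theta> r) n - cos_coefficient (\<theta>' r) n))"
      by (intro lebesgue_integral_eq_integral integrable_mult_right Bochner_Integration.integrable_diff i) auto
    finally show "cos_coefficient (\<theta> t) n - cos_coefficient (\<theta>' t) n = \<dots>" .
  qed (rule t)
  then have "AE x in unit_measure. \<theta> t x - \<theta>' t x = 0"
    by (intro L2_zero_if_cos_coefficients_zero L2_unit_diff L) (simp add: inner_unit_diff_left L cos_basis_L2)
  then show ?thesis by simp
qed

locale flat_heat = flat_output +
  fixes \<theta>0 :: "real \<Rightarrow> real" and \<tau> :: real
  assumes \<theta>0: "\<theta>0 \<in> L2_unit" and \<tau>: "0 < \<tau>"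
    and Y_eq: "\<And>k t. 0 < t \<Longrightarrow> t \<le> \<tau> \<Longrightarrow> Y k t = heat_trace (free_coeffs \<theta>0) k t"
begin

lemma flat_series_eq_free:
  assumes "0 < t" "t \<le> \<tau>"
  shows "flat_series Y q t x = flat_series (heat_trace (free_coeffs \<theta>0)) q t x"
  unfolding flat_series_def even_coeff_def using Y_eq[OF assms] by (simp cong: if_cong)

definition controlled_heat :: "real \<Rightarrow> real \<Rightarrow> real" where
  "controlled_heat t = (if t \<le> 0 then \<theta>0 else flat_series Y 0 t)"

definition flux :: "nat \<Rightarrow> real \<Rightarrow> real" where
  "flux k t = (if t \<le> 0 then 0 else boundary_flux k t)"

lemma flux_eq_0: "t \<le> \<tau> \<Longrightarrow> flux k t = 0"
  using bounded_coeffs.flat_series_heat_trace_boundary[OF bounded_free_coeffs[OF \<theta>0]]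
  by (simp add: flux_def boundary_flux_def flat_series_eq_free)

lemma deriv_seq_flux: "deriv_seq UNIV flux"
  unfolding deriv_seq_def
proof (intro allI ballI)
  fix k t
  show "(flux k has_real_derivative flux (Suc k) t) (at t)"
  proof (cases "t \<le> 0")
    case True
    have "((\<lambda>_. 0) has_real_derivative 0) (at t)" by simp
    then have "(flux k has_real_derivative 0) (at t)"
      by (rule has_field_derivative_transform_within_open[of _ _ _ "{..<\<tau>}"]) (use True \<tau> flux_eq_0 in auto)
    then show ?thesis using True by (simp add: flux_def)
  next
    case False
    then have "(boundary_flux k has_real_derivative boundary_flux (Suc k) t) (at t)"
      by (intro deriv_seqD[OF deriv_seq_boundary_flux]) auto
    then have "(flux k has_real_derivative boundary_flux (Suc k) t) (at t)"
      by (rule has_field_derivative_transform_within_open[of _ _ _ "{0<..}"]) (use False in \<open>auto simp: flux_def\<close>)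
    then show ?thesis using False by (simp add: flux_def)
  qed
qed

lemma gevrey_bound_flux: "gevrey_bound s UNIV flux"
proof -
  obtain M R where MR: "0 < M" "1 \<le> R" "\<And>t k. t \<in> {\<tau>..} \<Longrightarrow> \<bar>boundary_flux k t\<bar> \<le> M * fact k powr s * R ^ k"
    using gevrey_boundE[OF gevrey_bound_boundary_flux[OF \<tau>]] by metis
  have "\<bar>flux k t\<bar> \<le> M * fact k powr s * R ^ k" for k t
  proof (cases "t \<le> \<tau>")
    case True
    then show ?thesis using MR by (simp add: flux_eq_0)
  next
    case False
    then show ?thesis using MR(3)[of t k] \<tau> by (simp add: flux_def)
  qed
  then show ?thesis
    using MR unfolding gevrey_bound_def by (intro exI[of _ M] exI[of _ R] conjI) auto
qed

lemma continuous_on_flat_series: "0 < t \<Longrightarrow> continuous_on S (flat_series Y q t)"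
  by (intro continuous_at_imp_continuous_on ballI DERIV_isCont[OF flat_series_deriv_x])

lemma controlled_heat_L2: "controlled_heat t \<in> L2_unit"
  using \<theta>0 by (auto simp: controlled_heat_def intro!: L2_unit_continuous continuous_on_flat_series)

lemma continuous_into_L2_controlled_heat:
  assumes "0 < T"
  shows "continuous_into_L2 T controlled_heat"
  unfolding continuous_into_L2_def
proof (intro conjI ballI)
  fix t assume t: "t \<in> {0..T}"
  show "((\<lambda>r. L2_norm_unit (\<lambda>x. controlled_heat r x - controlled_heat t x)) \<longlongrightarrow> 0) (at t within {0..T})"
  proof (cases "t = 0")
    case True
    have "((\<lambda>r. L2_norm_unit (\<lambda>x. free_heat \<theta>0 r x - \<theta>0 x)) \<longlongrightarrow> 0) (at_right 0)"
      unfolding L2_norm_unit_eq using tendsto_real_sqrt[OF free_heat_tendsto_initial[OF \<theta>0]] by simp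
    moreover have "\<forall>\<^sub>F r in at_right 0. L2_norm_unit (\<lambda>x. free_heat \<theta>0 r x - \<theta>0 x) = L2_norm_unit (\<lambda>x. controlled_heat r x - controlled_heat t x)"
    proof -
      have "\<forall>\<^sub>F r in at_right 0. 0 < r \<and> r < \<tau>"
        using eventually_at_right_real[OF \<tau>] by eventually_elim simp
      then show ?thesis
        by eventually_elim (simp add: True controlled_heat_def flat_series_eq_free flat_series_free[OF \<theta>0])
    qed
    ultimately have "((\<lambda>r. L2_norm_unit (\<lambda>x. controlled_heat r x - controlled_heat t x)) \<longlongrightarrow> 0) (at_right 0)"
      using tendsto_cong by force
    then show ?thesis using True assms by (simp add: at_within_Icc_at_right)
  next
    case False
    then have t0: "0 < t" using t by auto
    obtain A W where AW: "1 \<le> A" "0 < W"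
      "\<And>q r x. t / 2 \<le> r \<Longrightarrow> \<bar>x\<bar> \<le> 1 \<Longrightarrow> \<bar>flat_series Y q r x\<bar> \<le> W * fact q powr (s / 2) * A ^ q"
      using flat_series_bound[of "t / 2" 1] t0 by (metis half_gt_zero)
    define K where "K = W * fact 2 powr (s / 2) * A ^ 2"
    have K: "0 \<le> K" using AW by (simp add: K_def)
    have le: "L2_norm_unit (\<lambda>x. controlled_heat r x - controlled_heat t x) \<le> K * \<bar>r - t\<bar>" if r: "t / 2 < r" for r
    proof -
      have pt: "\<bar>controlled_heat r x - controlled_heat t x\<bar> \<le> K * \<bar>r - t\<bar>" if x: "\<bar>x\<bar> \<le> 1" for x
      proof -
        have "norm (flat_series Y 0 r x - flat_series Y 0 t x) \<le> K * norm (r - t)"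
        proof (rule field_differentiable_bound[of "{t/2..}"])
          show "((\<lambda>t. flat_series Y 0 t x) has_field_derivative flat_series Y (0 + 2) z x) (at z within {t/2..})"
            if "z \<in> {t/2..}" for z
            by (rule has_field_derivative_at_within[OF flat_series_deriv_t]) (use that t0 in auto)
          show "norm (flat_series Y (0 + 2) z x) \<le> K" if "z \<in> {t/2..}" for z
            using AW(3)[of z x 2] that x by (simp add: K_def numeral_2_eq_2)
        qed (use t0 r in auto)
        then show ?thesis using t0 r by (simp add: controlled_heat_def)
      qed
      have "inner_unit (\<lambda>x. controlled_heat r x - controlled_heat t x) (\<lambda>x. controlled_heat r x - controlled_heat t x) \<le> (LINT x|unit_measure. (K * \<bar>r - t\<bar>) * (K * \<bar>r - t\<bar>))"
        unfolding inner_unit_def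
      proof (rule integral_mono)
        show "integrable unit_measure (\<lambda>x. (controlled_heat r x - controlled_heat t x) * (controlled_heat r x - controlled_heat t x))"
          by (intro L2_unit_mult_integrable L2_unit_diff controlled_heat_L2)
        show "integrable unit_measure (\<lambda>x. (K * \<bar>r - t\<bar>) * (K * \<bar>r - t\<bar>))"
          by (intro integrable_unit_continuous continuous_intros)
        fix x assume "x \<in> space unit_measure"
        then have "\<bar>controlled_heat r x - controlled_heat t x\<bar> * \<bar>controlled_heat r x - controlled_heat t x\<bar> \<le> (K * \<bar>r - t\<bar>) * (K * \<bar>r - t\<bar>)"
          using K by (intro mult_mono pt) auto
        then show "(controlled_heat r x - controlled_heat t x) * (controlled_heat r x - controlled_heat t x) \<le> (K * \<bar>r - t\<bar>) * (K * \<bar>r - t\<bar>)"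
          by (simp flip: abs_mult)
      qed
      also have "\<dots> = (K * \<bar>r - t\<bar>) * (K * \<bar>r - t\<bar>)"
        by (subst integral_unit_eq) auto
      finally show ?thesis
        unfolding L2_norm_unit_eq using K by (intro real_le_lsqrt) (auto simp: power2_eq_square)
    qed
    show ?thesis
    proof (rule Lim_null_comparison)
      have "\<forall>\<^sub>F r in at t within {0..T}. t / 2 < r"
        using t0 by (intro order_tendstoD(1)[OF tendsto_ident_at]) auto
      then show "\<forall>\<^sub>F r in at t within {0..T}. norm (L2_norm_unit (\<lambda>x. controlled_heat r x - controlled_heat t x)) \<le> K * \<bar>r - t\<bar>"
        by eventually_elim (use le in \<open>simp add: L2_norm_unit_eq inner_unit_nonneg\<close>)
      show "((\<lambda>r. K * \<bar>r - t\<bar>) \<longlongrightarrow> 0) (at t within {0..T})"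
        by (rule tendsto_eq_intros refl | simp)+
    qed
  qed
qed (rule controlled_heat_L2)

lemma inner_flat_series_laplacian:
  assumes \<phi>: "neumann_test \<phi> \<phi>1 \<phi>2" and t: "0 < t"
  shows "integral {0..1} (\<lambda>x. flat_series Y 2 t x * \<phi> x)
    = integral {0..1} (\<lambda>x. flat_series Y 0 t x * \<phi>2 x) + boundary_flux 0 t * \<phi> 1"
proof -
  have \<phi>': "\<And>x. x \<in> {0..1} \<Longrightarrow> (\<phi> has_real_derivative \<phi>1 x) (at x within {0..1})"
    "\<And>x. x \<in> {0..1} \<Longrightarrow> (\<phi>1 has_real_derivative \<phi>2 x) (at x within {0..1})"
    "continuous_on {0..1} \<phi>2" "\<phi>1 0 = 0" "\<phi>1 1 = 0"
    using \<phi> by (auto simp: neumann_test_def)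
  have c\<phi>: "continuous_on {0..1} \<phi>" using DERIV_continuous_on \<phi>'(1) by blast
  note D = flat_series_deriv_x[OF t, THEN has_field_derivative_at_within]
  have "((\<lambda>x. flat_series Y 2 t x * \<phi> x - flat_series Y 0 t x * \<phi>2 x) has_integral
     (flat_series Y 1 t 1 * \<phi> 1 - flat_series Y 0 t 1 * \<phi>1 1) - (flat_series Y 1 t 0 * \<phi> 0 - flat_series Y 0 t 0 * \<phi>1 0)) {0..1}"
  proof (rule fundamental_theorem_of_calculus)
    fix x :: real assume x: "x \<in> {0..1}"
    have "((\<lambda>x. flat_series Y 1 t x * \<phi> x - flat_series Y 0 t x * \<phi>1 x) has_real_derivative
       (flat_series Y (Suc 1) t x * \<phi> x + \<phi>1 x * flat_series Y 1 t x)
        - (flat_series Y (Suc 0) t x * \<phi>1 x + \<phi>2 x * flat_series Y 0 t x)) (at x within {0..1})"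
      by (intro DERIV_diff DERIV_mult D \<phi>'(1,2) x)
    then show "((\<lambda>x. flat_series Y 1 t x * \<phi> x - flat_series Y 0 t x * \<phi>1 x) has_vector_derivative
       flat_series Y 2 t x * \<phi> x - flat_series Y 0 t x * \<phi>2 x) (at x within {0..1})"
      by (simp add: has_real_derivative_iff_has_vector_derivative numeral_2_eq_2 mult.commute)
  qed simp
  moreover have "flat_series Y 1 t 0 = 0"
    unfolding flat_series_def powser_zero by (simp add: even_coeff_def)
  ultimately have "integral {0..1} (\<lambda>x. flat_series Y 2 t x * \<phi> x - flat_series Y 0 t x * \<phi>2 x) = boundary_flux 0 t * \<phi> 1"
    using \<phi>' by (simp add: integral_unique boundary_flux_def)
  moreover have "integral {0..1} (\<lambda>x. flat_series Y 2 t x * \<phi> x - flat_series Y 0 t x * \<phi>2 x)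
    = integral {0..1} (\<lambda>x. flat_series Y 2 t x * \<phi> x) - integral {0..1} (\<lambda>x. flat_series Y 0 t x * \<phi>2 x)"
    by (intro Henstock_Kurzweil_Integration.integral_diff integrable_continuous_real continuous_intros
        continuous_on_flat_series t c\<phi> \<phi>'(3))
  ultimately show ?thesis by linarith
qed

lemma controlled_heat_inner_deriv:
  assumes \<phi>: "neumann_test \<phi> \<phi>1 \<phi>2" and t: "0 < t"
  shows "((\<lambda>t. inner_unit (controlled_heat t) \<phi>) has_real_derivative inner_unit (controlled_heat t) \<phi>2 + flux 0 t * \<phi> 1) (at t)"
proof -
  have c: "continuous_on {0..1} \<phi>" "continuous_on {0..1} \<phi>2"
    using \<phi> DERIV_continuous_on unfolding neumann_test_def by blast+
  have eq: "inner_unit (controlled_heat r) g = integral {0..1} (\<lambda>x. flat_series Y 0 r x * g x)"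
    if "0 < r" "continuous_on {0..1} g" for r g
    unfolding inner_unit_def using that
    by (subst integral_unit_eq) (auto simp: controlled_heat_def intro!: continuous_intros continuous_on_flat_series)
  have "((\<lambda>t. integral (cbox 0 1) (\<lambda>x. flat_series Y 0 t x * \<phi> x)) has_field_derivative
      integral (cbox 0 1) (\<lambda>x. flat_series Y 2 t x * \<phi> x)) (at t within {0<..})"
  proof (rule leibniz_rule_field_derivative)
    show "((\<lambda>r. flat_series Y 0 r x * \<phi> x) has_field_derivative flat_series Y 2 r x * \<phi> x) (at r within {0<..})"
      if "r \<in> {0<..}" for r x
      using flat_series_deriv_t[of r 0 x] that
      by (intro DERIV_cmult_right) (auto simp: numeral_2_eq_2 intro: has_field_derivative_at_within)
    show "(\<lambda>x. flat_series Y 0 r x * \<phi> x) integrable_on cbox 0 1" if "r \<in> {0<..}" for r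
      using that c by (auto intro!: integrable_continuous_real continuous_intros continuous_on_flat_series)
    have "continuous_on ({0<..} \<times> cbox 0 1) (\<lambda>z. flat_series Y 2 (fst z) (snd z))"
      by (intro continuous_at_imp_continuous_on) (auto intro: flat_series_isCont)
    moreover have "continuous_on ({0<..} \<times> cbox 0 1) (\<lambda>z. \<phi> (snd z))"
      by (rule continuous_on_compose2[OF c(1)]) (auto intro!: continuous_intros)
    ultimately show "continuous_on ({0<..} \<times> cbox 0 1) (\<lambda>(r, x). flat_series Y 2 r x * \<phi> x)"
      unfolding case_prod_unfold by (rule continuous_on_mult)
  qed (use t in auto)
  then have "((\<lambda>t. integral {0..1} (\<lambda>x. flat_series Y 0 t x * \<phi> x)) has_real_derivative
      integral {0..1} (\<lambda>x. flat_series Y 2 t x * \<phi> x)) (at t)"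
    using t by (simp add: at_within_open[of t "{0<..}"])
  then have "((\<lambda>t. inner_unit (controlled_heat t) \<phi>) has_real_derivative integral {0..1} (\<lambda>x. flat_series Y 2 t x * \<phi> x)) (at t)"
    by (rule has_field_derivative_transform_within_open[of _ _ _ "{0<..}"]) (use t eq c in auto)
  then show ?thesis
    using inner_flat_series_laplacian[OF \<phi> t] t eq[OF t c(2)] by (simp add: flux_def)
qed

lemma heat_solution_controlled_heat:
  assumes T: "0 < T" and u: "\<And>t. t \<in> {0..T} \<Longrightarrow> u t = flux 0 t"
  shows "heat_solution T \<theta>0 u controlled_heat"
  unfolding heat_solution_def
proof (intro conjI allI impI ballI)
  have cu: "continuous_on S (flux 0)" for S
    using deriv_seq_continuous[OF deriv_seq_flux] continuous_on_subset by blast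
  then have "continuous_on {0..T} u"
    by (subst continuous_on_cong[OF refl u]) auto
  then show "integrable (lebesgue_on {0..T}) u" by (rule continuous_imp_integrable_real)
  show cont: "continuous_into_L2 T controlled_heat" by (rule continuous_into_L2_controlled_heat[OF T])
  show "AE x in unit_measure. controlled_heat 0 x = \<theta>0 x" by (simp add: controlled_heat_def)
  fix \<phi> \<phi>1 \<phi>2 t assume \<phi>: "neumann_test \<phi> \<phi>1 \<phi>2" and t: "t \<in> {0..T}"
  have L: "\<phi> \<in> L2_unit" "\<phi>2 \<in> L2_unit"
    using \<phi> DERIV_continuous_on unfolding neumann_test_def by (blast intro: L2_unit_continuous)+
  let ?h = "\<lambda>r. inner_unit (controlled_heat r) \<phi>2 + flux 0 r * \<phi> 1"
  have sub: "{0..t} \<subseteq> {0..T}" using t by auto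
  note c = continuous_on_subset[OF continuous_into_L2_inner[OF cont L(1)] sub]
    continuous_on_subset[OF continuous_into_L2_inner[OF cont L(2)] sub]
  have h: "continuous_on {0..t} ?h" by (intro continuous_intros c cu)
  have "(?h has_integral inner_unit (controlled_heat t) \<phi> - inner_unit (controlled_heat 0) \<phi>) {0..t}"
    using t controlled_heat_inner_deriv[OF \<phi>]
    by (intro fundamental_theorem_of_calculus_interior c)
       (auto simp: has_real_derivative_iff_has_vector_derivative)
  then have "integral {0..t} ?h = inner_unit (controlled_heat t) \<phi> - inner_unit \<theta>0 \<phi>"
    by (simp add: integral_unique controlled_heat_def)
  moreover have "integral {0..t} ?h = (LINT r|lebesgue_on {0..t}. ?h r)"
    by (intro lebesgue_integral_eq_integral[symmetric] continuous_imp_integrable_real h) auto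
  moreover have "(LINT r|lebesgue_on {0..t}. ?h r) = (LINT r|lebesgue_on {0..t}. inner_unit (controlled_heat r) \<phi>2 + u r * \<phi> 1)"
    by (rule Bochner_Integration.integral_cong[OF refl]) (use u t in \<open>auto simp: space_restrict_space\<close>)
  ultimately show "(LINT x|unit_measure. controlled_heat t x * \<phi> x) = (LINT x|unit_measure. \<theta>0 x * \<phi> x) +
      (LINT r|lebesgue_on {0..t}. (LINT x|unit_measure. controlled_heat r x * \<phi>2 x) + u r * \<phi> 1)"
    by (simp add: inner_unit_def)
qed

end

theorem theorem3:
  fixes \<theta>0 :: "real \<Rightarrow> real" and T \<tau> s :: real
  assumes "\<theta>0 \<in> L2_unit" and "0 < T" and "0 < \<tau>" and "\<tau> < T" and "1 < s" and "s < 2"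
  shows "\<exists>y :: real \<Rightarrow> real.
    gevrey_on_interval s \<tau> T y \<and>
    (\<forall>t\<in>{\<tau><..T}. summable (control_term \<tau> T y t)) \<and>
    gevrey_on_interval s 0 T (control \<tau> T y) \<and>
    (\<exists>\<theta>. heat_solution T \<theta>0 (control \<tau> T y) \<theta>) \<and>
    (\<forall>\<theta>. heat_solution T \<theta>0 (control \<tau> T y) \<theta> \<longrightarrow>
       (AE x in unit_measure. \<theta> T x = 0) \<and>
       (\<exists>g :: real \<times> real \<Rightarrow> real.
          (\<forall>t\<in>{0<..T}. AE x in unit_measure. \<theta> t x = g (t, x)) \<and>
          (\<forall>\<epsilon>\<in>{0<..<T}. gevrey_on_plane s (s / 2) ({\<epsilon>..T} \<times> {0..1}) g)))"
proof -
  obtain \<phi> where \<phi>: "deriv_seq {0<..} \<phi>" "gevrey_bound s {0<..} \<phi>"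
    "\<And>t k. 0 < t \<Longrightarrow> t \<le> \<tau> \<Longrightarrow> \<phi> k t = (if k = 0 then 1 else 0)"
    "\<And>t k. T \<le> t \<Longrightarrow> \<phi> k t = 0"
    using exists_gevrey_cutoff[OF assms(5,3,4)] by metis
  define c where "c = free_coeffs \<theta>0"
  interpret bounded_coeffs c "sqrt (inner_unit \<theta>0 \<theta>0) * 2"
    unfolding c_def by (rule bounded_free_coeffs[OF assms(1)])
  define Y where "Y = leibniz \<phi> (heat_trace c)"
  have Y0: "Y k t = heat_trace c k t" if "0 < t" "t \<le> \<tau>" for k t
  proof -
    have "Y k t = (\<Sum>j\<le>k. if j = 0 then heat_trace c k t else 0)"
      unfolding Y_def leibniz_def by (rule sum.cong) (simp_all add: \<phi>(3)[OF that])
    then show ?thesis by simp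
  qed
  have YT: "Y k t = 0" if "T \<le> t" for k t
    unfolding Y_def leibniz_def by (simp add: \<phi>(4)[OF that])
  interpret flat_heat Y s \<theta>0 \<tau>
  proof
    show "deriv_seq {0<..} Y"
      unfolding Y_def by (intro deriv_seq_leibniz \<phi>(1) deriv_seq_heat_trace)
    show "gevrey_bound s {\<epsilon>..} Y" if "0 < \<epsilon>" for \<epsilon>
      unfolding Y_def
      by (intro gevrey_bound_leibniz gevrey_bound_subset[OF \<phi>(2)]
          gevrey_bound_mono[OF gevrey_bound_heat_trace[OF that]]) (use that assms(5) in auto)
    show "Y k t = heat_trace (free_coeffs \<theta>0) k t" if "0 < t" "t \<le> \<tau>" for k t
      using Y0[OF that] by (simp add: c_def)
  qed (use assms in auto)
  have der: "(Y k has_real_derivative Y (Suc k) t) (at t within {\<tau>..T})" if "t \<in> {\<tau>..T}" for k t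
    by (rule has_field_derivative_at_within[OF deriv_seqD[OF Y]]) (use that assms(3) in auto)
  have D: "deriv_on \<tau> T k (Y 0) t = Y k t" if "t \<in> {\<tau>..T}" for k t
    by (rule deriv_on_eq[where f = Y]) (use der that assms(4) in auto)
  have sums: "control_term \<tau> T (Y 0) t sums boundary_flux 0 t" if "t \<in> {\<tau><..T}" for t
    using sums_boundary_flux[of t] that assms(3) D[of t] by (simp add: control_term_def[abs_def])
  have u: "control \<tau> T (Y 0) t = flux 0 t" if "t \<in> {0..T}" for t
  proof (cases "t \<le> \<tau>")
    case True
    then show ?thesis by (simp add: control_def flux_eq_0)
  next
    case False
    then show ?thesis
      using that assms(3) sums_unique[OF sums[of t]] by (simp add: control_def flux_def)
  qed
  have sol: "heat_solution T \<theta>0 (control \<tau> T (Y 0)) controlled_heat"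
    by (rule heat_solution_controlled_heat[OF assms(2) u])
  have "even_coeff Y m T = 0" for m
    by (simp add: even_coeff_def YT)
  then have final: "controlled_heat T x = 0" for x
    using assms(2) by (simp add: controlled_heat_def flat_series_def)
  show ?thesis
  proof (intro exI[of _ "Y 0"] conjI allI impI ballI)
    show "gevrey_on_interval s \<tau> T (Y 0)"
      by (rule gevrey_on_intervalI[where f = Y])
         (use der assms in \<open>auto intro!: gevrey_bound_subset[OF Y_bound[of \<tau>]]\<close>)
    show "summable (control_term \<tau> T (Y 0) t)" if "t \<in> {\<tau><..T}" for t
      using sums[OF that] by (rule sums_summable)
    show "gevrey_on_interval s 0 T (control \<tau> T (Y 0))"
    proof (rule gevrey_on_intervalI[where f = flux])
      show "(flux k has_real_derivative flux (Suc k) t) (at t within {0..T})" for k t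
        by (rule has_field_derivative_at_within[OF deriv_seqD[OF deriv_seq_flux]]) simp
    qed (use assms(2) u in \<open>auto intro: gevrey_bound_subset[OF gevrey_bound_flux]\<close>)
    show "\<exists>\<theta>. heat_solution T \<theta>0 (control \<tau> T (Y 0)) \<theta>"
      using sol by blast
    fix \<theta>' assume \<theta>': "heat_solution T \<theta>0 (control \<tau> T (Y 0)) \<theta>'"
    note eq = heat_solution_unique[OF \<theta>' sol]
    show "AE x in unit_measure. \<theta>' T x = 0"
      using eq[of T] assms(2) by (simp add: final)
    show "\<exists>g. (\<forall>t\<in>{0<..T}. AE x in unit_measure. \<theta>' t x = g (t, x)) \<and>
          (\<forall>\<epsilon>\<in>{0<..<T}. gevrey_on_plane s (s / 2) ({\<epsilon>..T} \<times> {0..1}) g)"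
    proof (intro exI[of _ "\<lambda>z. flat_series Y 0 (fst z) (snd z)"] conjI ballI)
      show "AE x in unit_measure. \<theta>' t x = flat_series Y 0 (fst (t, x)) (snd (t, x))" if "t \<in> {0<..T}" for t
        using eq[of t] that by (simp add: controlled_heat_def)
      show "gevrey_on_plane s (s / 2) ({\<epsilon>..T} \<times> {0..1}) (\<lambda>z. flat_series Y 0 (fst z) (snd z))"
        if "\<epsilon> \<in> {0<..<T}" for \<epsilon>
        using that by (intro gevrey_on_plane_flat_series) auto
    qed
  qed
qed

end
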